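(* Let $\mathcal{M}$ be the randomized algorithm DP-AGD described in the context below, run with total privacy parameters $\epsilon_{\mathsf{tot}}>0$, $\delta_{\mathsf{tot}}\in(0,1)$ and any admissible values of its other inputs. Let $\rho>0$ be the value satisfying $\epsilon_{\mathsf{tot}} = \rho + 2\sqrt{\rho\log(1/\delta_{\mathsf{tot}})}$. Then the mechanism $D\mapsto \mathcal{M}(D)$ (whose output is the returned parameter vector) satisfies $\rho$-zCDP, and it satisfies $(\epsilon_{\mathsf{tot}},\delta_{\mathsf{tot}})$-differential privacy.
   Context: Databases: $D=\{d_1,\dots,d_n\}$ is a finite multiset of records from a domain $\mathcal{D}$, with $d_i=(\vec x_i,y_i)$, $\vec x_i\in\mathbb{R}^p$, $y_i\in\mathbb{R}$. Two databases $D,D'$ are neighbors ($D\sim D'$) if one is obtained from the other by adding or removing a single record. Differential privacy: a randomized mechanism $\mathcal{M}$ is $(\epsilon,\delta)$-DP if for all $D\sim D'$ and all measurable events $S$, $\Pr[\mathcal{M}(D)\in S]\le e^{\epsilon}\Pr[\mathcal{M}(D')\in S]+\delta$. zCDP: $\mathcal{M}$ satisfies $\rho$-zCDP if for all $D\sim D'$ and all $\alpha\in(1,\infty)$, $D_\alpha(\mathcal{M}(D)\,\|\,\mathcal{M}(D'))\le \alpha\rho$, where $D_\alpha$ is the Rényi divergence of order $\alpha$ (equivalently $\mathbb{E}[e^{(\alpha-1)Z}]\le e^{(\alpha-1)\alpha\rho}$ for the privacy loss random variable $Z$). NoisyMax$(\Omega,\Delta,\epsilon)$: given a finite list of real numbers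 $\Omega=(v_0,\dots,v_{m-1})$, add to each $v_j$ an independent $\mathrm{Lap}(\Delta/\epsilon)$ random variable (Laplace with mean $0$, scale $\Delta/\epsilon$) and return the index $j$ of the largest noisy value. Problem: a loss function $\ell(\vec w;d)\ge 0$ for $\vec w\in\mathbb{R}^p$, differentiable in $\vec w$ (an optional data-independent regularizer such as $\frac\lambda2\|\vec w\|_2^2$ may be added to the objective). Clipped objective: $f_C(\vec w;D)=\sum_{i=1}^n \min(\ell(\vec w;d_i),C_{\mathsf{obj}})$. Algorithm DP-AGD. Inputs: data $D$; $\epsilon_{\mathsf{tot}},\delta_{\mathsf{tot}}$; initial budgets $\rho_{\mathsf{nmax}}>0$, $\rho_{\mathsf{ng}}>0$; rate $\gamma>0$; clipping thresholds $C_{\mathsf{obj}},C_{\mathsf{grad}}>0$; a data-independent initial point $\vec w_0$ and a finite set of step sizes $\Phi=\{\alpha_0=0,\alpha_1,\dots,\alpha_{m-1}\}$ (which may be updated between iterations as any function of previously chosen step sizes). Set $\rho$ to the solution of $\epsilon_{\mathsf{tot}}=\rho+2\sqrt{\rho\log(1/\delta_{\mathsf{tot}})}$ and $t\gets0$. While $\rho>0$: (1) compute $\vec g_t=\sum_{i=1}^n \nabla\ell(\vec w_t;d_i)/\max(1,\|\nabla\ell(\vec w_t;d_i)\|_2/C_{\mathsf{grad}})$; set $\tilde{\vec g}_t=\vec g_t+N(0,(C_{\mathsf{grad}}^2/(2\rho_{\mathsf{ng}}))I)$; $\rho\gets\rho-\rho_{\mathsf{ng}}$; $\tilde{\vec g}_t\gets\tilde{\vec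 g}_t/\|\tilde{\vec g}_t\|_2$. (2) Set $i\gets0$ and repeat while $i=0$: let $\Omega=(f_C(\vec w_t-\alpha\tilde{\vec g}_t;D))_{\alpha\in\Phi}$; $\rho\gets\rho-\rho_{\mathsf{nmax}}$; $i\gets$ NoisyMax$(-\Omega,C_{\mathsf{obj}},\sqrt{2\rho_{\mathsf{nmax}}})$. If $i>0$: if $\rho>0$ set $\vec w_{t+1}\gets\vec w_t-\alpha_i\tilde{\vec g}_t$. If $i=0$: $\rho_{\mathsf{old}}\gets\rho_{\mathsf{ng}}$, $\rho_{\mathsf{ng}}\gets(1+\gamma)\rho_{\mathsf{ng}}$, draw $\tilde{\vec g}_2=\vec g_t+N(0,(C_{\mathsf{grad}}^2/(2(\rho_{\mathsf{ng}}-\rho_{\mathsf{old}})))I)$, set $\tilde{\vec g}_t\gets(\rho_{\mathsf{old}}\tilde{\vec g}_t+(\rho_{\mathsf{ng}}-\rho_{\mathsf{old}})\tilde{\vec g}_2)/\rho_{\mathsf{ng}}$, and $\rho\gets\rho-(\rho_{\mathsf{ng}}-\rho_{\mathsf{old}})$. (3) $t\gets t+1$. Output: the most recently assigned parameter vector $\vec w$ (an iterate only ever assigned while the remaining budget $\rho$ is positive). *)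

theory Defs
  imports "HOL-Probability.Probability" "HOL-Library.Multiset"
begin

definition neighbors :: "'d multiset \<Rightarrow> 'd multiset \<Rightarrow> bool" where
  "neighbors D D' \<longleftrightarrow> (\<exists>d. D' = D + {#d#} \<or> D = D' + {#d#})"

definition renyi_divergence :: "real \<Rightarrow> 'b measure \<Rightarrow> 'b measure \<Rightarrow> ereal" where
  "renyi_divergence \<alpha> P Q =
     (if sets P = sets Q \<and> absolutely_continuous Q P then
        (let I = (\<integral>\<^sup>+ x. ennreal (enn2real (RN_deriv Q P x) powr \<alpha>) \<partial>Q)
         in if I = \<infinity> then \<infinity> else ereal (ln (enn2real I) / (\<alpha> - 1)))
      else \<infinity>)"

definition zCDP :: "real \<Rightarrow> ('d multiset \<Rightarrow> 'b measure) \<Rightarrow> bool" where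
  "zCDP \<rho> M \<longleftrightarrow>
     (\<forall>D D'. neighbors D D' \<longrightarrow> (\<forall>\<alpha>>1. renyi_divergence \<alpha> (M D) (M D') \<le> ereal (\<alpha> * \<rho>)))"

definition DP :: "real \<Rightarrow> real \<Rightarrow> ('d multiset \<Rightarrow> 'b measure) \<Rightarrow> bool" where
  "DP \<epsilon> \<delta> M \<longleftrightarrow>
     (\<forall>D D'. neighbors D D' \<longrightarrow>
        (\<forall>S \<in> sets (M D). measure (M D) S \<le> exp \<epsilon> * measure (M D') S + \<delta>))"

definition laplace :: "real \<Rightarrow> real measure" where
  "laplace b = density lborel (\<lambda>x. ennreal (exp (- \<bar>x\<bar> / b) / (2 * b)))"

definition gauss_vec :: "real \<Rightarrow> 'a::euclidean_space measure" where
  "gauss_vec s2 = density lborel (\<lambda>x. ennreal (\<Prod>b\<in>Basis. normal_density 0 (sqrt s2) (x \<bullet> b)))"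

text \<open>Index of the largest noisy value (ties, a null event, broken towards the smallest index).\<close>
definition argmax_idx :: "real list \<Rightarrow> (nat \<Rightarrow> real) \<Rightarrow> nat" where
  "argmax_idx v z = (LEAST j. j < length v \<and> (\<forall>k<length v. v ! k + z k \<le> v ! j + z j))"

definition noisy_max :: "real list \<Rightarrow> real \<Rightarrow> real \<Rightarrow> nat measure" where
  "noisy_max v \<Delta> \<epsilon> =
     distr (PiM {..<length v} (\<lambda>_. laplace (\<Delta> / \<epsilon>))) (count_space UNIV) (argmax_idx v)"

definition grad :: "('a::real_inner \<Rightarrow> real) \<Rightarrow> 'a \<Rightarrow> 'a" where
  "grad f w = (SOME g. GDERIV f w :> g)"

definition clipped_grad ::
  "('a::euclidean_space \<Rightarrow> 'a \<times> real \<Rightarrow> real) \<Rightarrow> ('a \<times> real) multiset \<Rightarrow> real \<Rightarrow> 'a \<Rightarrow> 'a" where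
  "clipped_grad loss D Cgrad w =
     sum_mset (image_mset (\<lambda>d. grad (\<lambda>v. loss v d) w /\<^sub>R max 1 (norm (grad (\<lambda>v. loss v d) w) / Cgrad)) D)"

definition clipped_obj ::
  "('a \<Rightarrow> 'a \<times> real \<Rightarrow> real) \<Rightarrow> real \<Rightarrow> ('a \<times> real) multiset \<Rightarrow> 'a \<Rightarrow> real" where
  "clipped_obj loss Cobj D w = sum_mset (image_mset (\<lambda>d. min (loss w d) Cobj) D)"

text \<open>Main loop of DP-AGD with a fuel counter. The state is
  (w, remaining rho, rho_ng, list of previously chosen step sizes, phase), where phase = None
  means "at the top of the outer while loop" and phase = Some g means "inside the repeat loop
  of step (2) with current direction g".  As soon as the remaining budget is non-positive the
  current (last assigned) iterate is returned, since no further iterate can be assigned.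
  The regulariser r (data independent) is added to the objective: its gradient is added to
  the noisy gradient, and its value to every entry of Omega.\<close>
primrec dpagd_loop ::
  "('a::euclidean_space \<Rightarrow> 'a \<times> real \<Rightarrow> real) \<Rightarrow> ('a \<Rightarrow> real) \<Rightarrow> real \<Rightarrow> real \<Rightarrow> real \<Rightarrow> real \<Rightarrow>
   (real list \<Rightarrow> real list) \<Rightarrow> ('a \<times> real) multiset \<Rightarrow> nat \<Rightarrow>
   'a \<times> real \<times> real \<times> real list \<times> 'a option \<Rightarrow> 'a measure" where
  "dpagd_loop loss r Cobj Cgrad \<rho>nmax \<gamma> \<Phi> D 0 s = return borel (fst s)"
| "dpagd_loop loss r Cobj Cgrad \<rho>nmax \<gamma> \<Phi> D (Suc k) s =
    (case s of (w, \<rho>, \<rho>ng, hist, ph) \<Rightarrow>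
      if \<rho> \<le> 0 then return borel w else
      (case ph of
        None \<Rightarrow>
          gauss_vec (Cgrad\<^sup>2 / (2 * \<rho>ng)) \<bind> (\<lambda>z.
            let g = clipped_grad loss D Cgrad w + grad r w + z
            in dpagd_loop loss r Cobj Cgrad \<rho>nmax \<gamma> \<Phi> D k (w, \<rho> - \<rho>ng, \<rho>ng, hist, Some (g /\<^sub>R norm g)))
      | Some gt \<Rightarrow>
          (let steps = \<Phi> hist;
               \<Omega> = map (\<lambda>\<alpha>. clipped_obj loss Cobj D (w - \<alpha> *\<^sub>R gt) + r (w - \<alpha> *\<^sub>R gt)) steps;
               \<rho>' = \<rho> - \<rho>nmax
           in noisy_max (map uminus \<Omega>) Cobj (sqrt (2 * \<rho>nmax)) \<bind> (\<lambda>i.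
                if 0 < i then
                  (if \<rho>' > 0 then
                     dpagd_loop loss r Cobj Cgrad \<rho>nmax \<gamma> \<Phi> D k
                       (w - (steps ! i) *\<^sub>R gt, \<rho>', \<rho>ng, hist @ [steps ! i], None)
                   else return borel w)
                else
                  (let \<rho>ng' = (1 + \<gamma>) * \<rho>ng in
                   gauss_vec (Cgrad\<^sup>2 / (2 * (\<rho>ng' - \<rho>ng))) \<bind> (\<lambda>z.
                     let g2 = clipped_grad loss D Cgrad w + grad r w + z
                     in dpagd_loop loss r Cobj Cgrad \<rho>nmax \<gamma> \<Phi> D k
                          (w, \<rho>' - (\<rho>ng' - \<rho>ng), \<rho>ng', hist,
                           Some ((\<rho>ng *\<^sub>R gt + (\<rho>ng' - \<rho>ng) *\<^sub>R g2) /\<^sub>R \<rho>ng'))))))))"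

text \<open>The mechanism D |-> DP-AGD(D). The budget rho is the solution of
  eps = rho + 2 sqrt(rho log(1/delta)). The fuel 2*ceil(rho/rho_nmax)+4 is never exhausted
  while the remaining budget is positive (each noisy-max call costs rho_nmax > 0).\<close>
definition dpagd ::
  "('a::euclidean_space \<Rightarrow> 'a \<times> real \<Rightarrow> real) \<Rightarrow> ('a \<Rightarrow> real) \<Rightarrow> real \<Rightarrow> real \<Rightarrow> real \<Rightarrow> real \<Rightarrow> real \<Rightarrow>
   'a \<Rightarrow> (real list \<Rightarrow> real list) \<Rightarrow> real \<Rightarrow> real \<Rightarrow> ('a \<times> real) multiset \<Rightarrow> 'a measure" where
  "dpagd loss r Cobj Cgrad \<rho>nmax \<rho>ng \<gamma> w0 \<Phi> \<epsilon> \<delta> D =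
     (let \<rho> = (THE \<rho>. 0 < \<rho> \<and> \<epsilon> = \<rho> + 2 * sqrt (\<rho> * ln (1 / \<delta>)))
      in dpagd_loop loss r Cobj Cgrad \<rho>nmax \<gamma> \<Phi> D (2 * nat \<lceil>\<rho> / \<rho>nmax\<rceil> + 4) (w0, \<rho>, \<rho>ng, [], None))"

end

(* A bound on the Renyi divergence of order alpha is used in its Hoelder-dual form: for every test
   function h with values in [0,1], E_P h <= c * (E_Q h^beta)^(1/beta), where 1/alpha + 1/beta = 1.
   In this form the bounds multiply under adaptive composition of kernels, with no need for
   measurable families of Radon-Nikodym derivatives, and both the Renyi divergence bound (test
   with truncated powers of dP/dQ) and the (epsilon, delta) bound (test with indicators) can be
   read off. Gaussian noise gives the dual bound by completing the square. The noisy maximum is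
   purely sqrt(2 rho_nmax)-DP because adding a record moves all clipped objectives in the same
   direction, and pure epsilon-DP gives epsilon^2/2-zCDP because the second derivative of the
   cumulant generating function of the privacy loss is at most epsilon^2. Induction on the fuel
   then bounds the loop by its remaining budget. *)
theory Submission
  imports Defs
begin

section \<open>Renyi bounds in dual form\<close>

text \<open>Values in [0,1] keep every integral finite and make the test class stable: with \<beta>
  the exponent conjugate to \<alpha> and L a kernel, the map sending x to (integral of h^\<beta>
  under L x)^(1/\<beta>) is again a measurable test function with values in [0,1]. Composition
  therefore applies the definition twice. The order \<alpha> stays fixed throughout, and with
  constants of the form exp ((\<alpha> - 1) * \<rho>) a product of constants is a sum of budgets.
  The number of steps, the noise levels and the step sizes are decided by earlier noisy outcomes, so
  the total cost is not a sum fixed in advance. The remaining budget, however, is part of the loop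
  state, and two runs on neighboring databases are always compared from one and the same state; this
  is why the induction is stated for arbitrary states and bounds each by its own budget.\<close>

text \<open>By Hoelder duality this says that the integral of (dP/dQ) powr \<alpha> over Q is at most c powr \<alpha>;
  \<alpha> / (\<alpha> - 1) is the conjugate exponent and 1 - 1 / \<alpha> its inverse. A \<rho>-zCDP bound at order \<alpha>
  is c = exp ((\<alpha> - 1) * \<rho>).\<close>
definition renyi_bounded :: "real \<Rightarrow> real \<Rightarrow> 'b measure \<Rightarrow> 'b measure \<Rightarrow> bool" where
  "renyi_bounded \<alpha> c P Q \<longleftrightarrow> sets P = sets Q \<and>
     (\<forall>h\<in>borel_measurable Q. (\<forall>x\<in>space Q. 0 \<le> h x \<and> h x \<le> 1) \<longrightarrow>
        integral\<^sup>L P h \<le> c * (\<integral>x. h x powr (\<alpha> / (\<alpha> - 1)) \<partial>Q) powr (1 - 1 / \<alpha>))"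

lemma renyi_boundedD:
  assumes "renyi_bounded \<alpha> c P Q" "h \<in> borel_measurable Q" "\<And>x. x \<in> space Q \<Longrightarrow> 0 \<le> h x \<and> h x \<le> (1::real)"
  shows "integral\<^sup>L P h \<le> c * (\<integral>x. h x powr (\<alpha> / (\<alpha> - 1)) \<partial>Q) powr (1 - 1 / \<alpha>)"
  using assms unfolding renyi_bounded_def by blast

text \<open>The slack c \<ge> 1 allows a run that stops early to be charged the whole budget it
  still had.\<close>

lemma renyi_bounded_return:
  assumes "1 < \<alpha>" "1 \<le> c" "x \<in> space M"
  shows "renyi_bounded \<alpha> c (return M x) (return M x)"
  unfolding renyi_bounded_def
proof (intro conjI ballI impI)
  fix h :: "_ \<Rightarrow> real"
  assume h [measurable]: "h \<in> borel_measurable (return M x)"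
    and bd: "\<forall>y\<in>space (return M x). 0 \<le> h y \<and> h y \<le> 1"
  have [measurable]: "h \<in> borel_measurable M" using h by simp
  have "0 \<le> h x" using bd assms by simp
  then have "(h x powr (\<alpha> / (\<alpha> - 1))) powr (1 - 1 / \<alpha>) = h x"
    using assms by (simp add: powr_powr field_simps)
  moreover have "h x \<le> c * h x" using \<open>0 \<le> h x\<close> \<open>1 \<le> c\<close> by (simp add: mult_le_cancel_right1)
  ultimately show "integral\<^sup>L (return M x) h
      \<le> c * (\<integral>x. h x powr (\<alpha> / (\<alpha> - 1)) \<partial>return M x) powr (1 - 1 / \<alpha>)"
    using assms by (simp add: integral_return)
qed simp

lemma (in prob_space) integral_in_unit_interval:
  assumes [measurable]: "h \<in> borel_measurable M" and "\<And>x. x \<in> space M \<Longrightarrow> 0 \<le> h x \<and> h x \<le> (1::real)"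
  shows "integrable M h" "0 \<le> integral\<^sup>L M h" "integral\<^sup>L M h \<le> 1"
proof -
  show "integrable M h"
    by (rule integrable_const_bound[where B=1]) (use assms in auto)
  show "0 \<le> integral\<^sup>L M h" using assms by (intro Bochner_Integration.integral_nonneg) auto
  have "integral\<^sup>L M h \<le> (\<integral>x. 1 \<partial>M)"
    by (intro integral_mono \<open>integrable M h\<close>) (use assms in auto)
  then show "integral\<^sup>L M h \<le> 1" by (simp add: prob_space)
qed

text \<open>The kernel bound replaces the inner integral of h by d * H, where H is the
  (1/\<beta>)-th power of the inner integral of h^\<beta> under L. H takes values in [0,1], so the
  bound for P and Q applies to it; its \<beta>-th power is the inner integral itself, whose integral
  under Q is that of h^\<beta> under \<open>Q \<bind> L\<close>.\<close>

lemma renyi_bounded_bind: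
  assumes \<alpha>: "1 < \<alpha>"
    and P: "P \<in> space (prob_algebra M)" and Q: "Q \<in> space (prob_algebra M)"
    and K[measurable]: "K \<in> M \<rightarrow>\<^sub>M prob_algebra N" and L[measurable]: "L \<in> M \<rightarrow>\<^sub>M prob_algebra N"
    and c: "0 \<le> c" and d: "0 \<le> d"
    and PQ: "renyi_bounded \<alpha> c P Q"
    and KL: "\<And>x. x \<in> space M \<Longrightarrow> renyi_bounded \<alpha> d (K x) (L x)"
  shows "renyi_bounded \<alpha> (c * d) (P \<bind> K) (Q \<bind> L)"
proof -
  have prob: "prob_space P" "prob_space Q" and sets[measurable_cong]: "sets P = sets M" "sets Q = sets M"
    using P Q by (auto simp: space_prob_algebra)
  have sp: "space P = space M" "space Q = space M" using sets by (auto dest: sets_eq_imp_space_eq)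
  interpret P: prob_space P by fact
  interpret Q: prob_space Q by fact
  have KP: "K \<in> P \<rightarrow>\<^sub>M subprob_algebra N" and LQ: "L \<in> Q \<rightarrow>\<^sub>M subprob_algebra N"
    using measurable_prob_algebraD[OF K] measurable_prob_algebraD[OF L]
    by (simp_all add: measurable_cong_sets[OF sets(1) refl] measurable_cong_sets[OF sets(2) refl])
  have sb: "sets (P \<bind> K) = sets N" "sets (Q \<bind> L) = sets N"
    by (rule sets_bind[OF sets_kernel[OF KP] P.not_empty], assumption,
        rule sets_bind[OF sets_kernel[OF LQ] Q.not_empty], assumption)
  have pk: "prob_space (K x)" "prob_space (L x)" and sk: "sets (K x) = sets N" "sets (L x) = sets N"
     and spk: "space (K x) = space N" "space (L x) = space N"
    if "x \<in> space M" for x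
    using measurable_space[OF K that] measurable_space[OF L that]
    by (auto simp: space_prob_algebra dest: sets_eq_imp_space_eq)
  show ?thesis unfolding renyi_bounded_def
  proof (intro conjI ballI impI)
    show "sets (P \<bind> K) = sets (Q \<bind> L)" using sb by simp
    fix h :: "_ \<Rightarrow> real"
    assume h: "h \<in> borel_measurable (Q \<bind> L)" and bd': "\<forall>x\<in>space (Q \<bind> L). 0 \<le> h x \<and> h x \<le> 1"
    have [measurable]: "h \<in> borel_measurable N" using h by (simp add: measurable_cong_sets[OF sb(2) refl])
    have bd: "0 \<le> h x \<and> h x \<le> 1" if "x \<in> space N" for x
      using bd' that sb by (auto dest: sets_eq_imp_space_eq)
    define g where "g = (\<lambda>x. h x powr (\<alpha> / (\<alpha> - 1)))"
    have [measurable]: "g \<in> borel_measurable N" unfolding g_def by measurable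
    have gbd: "0 \<le> g x \<and> g x \<le> 1" if "x \<in> space N" for x
      using bd[OF that] \<alpha> unfolding g_def by (auto intro!: powr_le1)
    have bind_int: "integral\<^sup>L (R \<bind> T) f = (\<integral>x. integral\<^sup>L (T x) f \<partial>R)"
      if R: "prob_space R" "sets R = sets M" and T: "T \<in> M \<rightarrow>\<^sub>M prob_algebra N"
        and f: "f \<in> borel_measurable N" "\<And>x. x \<in> space N \<Longrightarrow> 0 \<le> f x \<and> f x \<le> (1::real)" for R T f
    proof (rule integral_bind[where B=1 and B'=1 and K=N])
      interpret R: prob_space R by fact
      show "finite_measure R" by (rule R.finite_measure_axioms)
      show "T \<in> R \<rightarrow>\<^sub>M subprob_algebra N"
        using measurable_prob_algebraD[OF T] by (simp add: measurable_cong_sets[OF R(2) refl])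
      then show "AE x in R. emeasure (T x) (space (T x)) \<le> ennreal 1"
        by (intro AE_I2) (auto simp: subprob_space.emeasure_space_le_1 subprob_space_kernel)
      show "\<bar>f x\<bar> \<le> 1" if "x \<in> space N" for x using f(2)[OF that] by simp
    qed (fact f(1))
    have int: "integral\<^sup>L (P \<bind> K) f = (\<integral>x. integral\<^sup>L (K x) f \<partial>P)"
              "integral\<^sup>L (Q \<bind> L) f = (\<integral>x. integral\<^sup>L (L x) f \<partial>Q)"
      if "f \<in> borel_measurable N" "\<And>x. x \<in> space N \<Longrightarrow> 0 \<le> f x \<and> f x \<le> (1::real)" for f
      using that by (auto intro!: bind_int prob sets K L)
    have Sm: "K \<in> M \<rightarrow>\<^sub>M subprob_algebra N" "L \<in> M \<rightarrow>\<^sub>M subprob_algebra N"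
      using K L by (auto intro: measurable_prob_algebraD)
    define G where "G = (\<lambda>x. integral\<^sup>L (L x) g)"
    have [measurable]: "G \<in> borel_measurable M" unfolding G_def
      by (rule measurable_compose[OF Sm(2) integral_measurable_subprob_algebra]) measurable
    have hK[measurable]: "(\<lambda>x. integral\<^sup>L (K x) h) \<in> borel_measurable M"
      by (rule measurable_compose[OF Sm(1) integral_measurable_subprob_algebra]) measurable
    have Gbd: "0 \<le> G x \<and> G x \<le> 1" if "x \<in> space M" for x
      unfolding G_def using prob_space.integral_in_unit_interval[OF pk(2)[OF that], of g] gbd sk[OF that] spk[OF that]
      by (auto cong: measurable_cong_sets)
    have hKbd: "0 \<le> integral\<^sup>L (K x) h \<and> integral\<^sup>L (K x) h \<le> 1" if "x \<in> space M" for x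
      using prob_space.integral_in_unit_interval[OF pk(1)[OF that], of h] bd sk[OF that] spk[OF that]
      by (auto cong: measurable_cong_sets)
    define H where "H = (\<lambda>x. G x powr (1 - 1 / \<alpha>))"
    have [measurable]: "H \<in> borel_measurable M" unfolding H_def by measurable
    have Hbd: "0 \<le> H x \<and> H x \<le> 1" if "x \<in> space M" for x
      unfolding H_def using Gbd[OF that] \<alpha> by (auto intro!: powr_le1)
    have "integral\<^sup>L (P \<bind> K) h = (\<integral>x. integral\<^sup>L (K x) h \<partial>P)"
      by (rule int) (use bd in auto)
    also have "\<dots> \<le> (\<integral>x. d * H x \<partial>P)"
    proof (rule integral_mono)
      show "integrable P (\<lambda>x. integral\<^sup>L (K x) h)"
        by (rule P.integral_in_unit_interval) (use hKbd sp in auto)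
      show "integrable P (\<lambda>x. d * H x)"
        by (intro integrable_mult_right P.integral_in_unit_interval) (use Hbd sp in auto)
      show "integral\<^sup>L (K x) h \<le> d * H x" if "x \<in> space P" for x
        using renyi_boundedD[OF KL, of x h] that sp bd sk spk unfolding H_def G_def g_def
        by (auto cong: measurable_cong_sets)
    qed
    also have "\<dots> = d * (\<integral>x. H x \<partial>P)" by simp
    also have "\<dots> \<le> d * (c * (\<integral>x. H x powr (\<alpha> / (\<alpha> - 1)) \<partial>Q) powr (1 - 1 / \<alpha>))"
      by (intro mult_left_mono renyi_boundedD[OF PQ] d) (use Hbd sp in auto)
    also have "(\<integral>x. H x powr (\<alpha> / (\<alpha> - 1)) \<partial>Q) = (\<integral>x. G x \<partial>Q)"
    proof (rule Bochner_Integration.integral_cong[OF refl])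
      fix x assume "x \<in> space Q"
      then have "0 \<le> G x" using Gbd sp by auto
      moreover have "(1 - 1 / \<alpha>) * (\<alpha> / (\<alpha> - 1)) = 1" using \<alpha> by (simp add: field_simps)
      ultimately show "H x powr (\<alpha> / (\<alpha> - 1)) = G x" unfolding H_def by (simp only: powr_powr) simp
    qed
    also have "\<dots> = integral\<^sup>L (Q \<bind> L) g" unfolding G_def
      by (rule int(2)[symmetric]) (use gbd in auto)
    finally show "integral\<^sup>L (P \<bind> K) h
       \<le> c * d * (\<integral>x. h x powr (\<alpha> / (\<alpha> - 1)) \<partial>(Q \<bind> L)) powr (1 - 1 / \<alpha>)"
      unfolding g_def by (simp add: mult_ac)
  qed
qed

text \<open>This is Hoelder's inequality, obtained from Young's inequality for f / c and h / r,
  where r is the \<beta>-norm of h. Concrete noise distributions enter the dual calculus through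
  this lemma.\<close>

lemma renyi_bounded_density:
  assumes \<alpha>: "1 < \<alpha>" and c: "0 < c" and prob: "prob_space P" "prob_space Q"
    and f[measurable]: "f \<in> borel_measurable Q" and f0: "\<And>x. x \<in> space Q \<Longrightarrow> 0 \<le> f x"
    and P: "P = density Q (\<lambda>x. ennreal (f x))"
    and le: "(\<integral>\<^sup>+x. ennreal (f x powr \<alpha>) \<partial>Q) \<le> ennreal (c powr \<alpha>)"
  shows "renyi_bounded \<alpha> c P Q"
  unfolding renyi_bounded_def
proof (intro conjI ballI impI)
  show "sets P = sets Q" by (simp add: P)
  interpret P: prob_space P by fact
  interpret Q: prob_space Q by fact
  have fin: "integrable Q f"
  proof (rule integrableI_nonneg)
    have "(\<integral>\<^sup>+x. ennreal (f x) \<partial>Q) = emeasure P (space P)"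
      unfolding P by (simp add: emeasure_density cong: nn_integral_cong)
    then show "(\<integral>\<^sup>+x. ennreal (f x) \<partial>Q) < \<infinity>" by (simp add: P.emeasure_space_1)
  qed (use f0 in auto)
  have intf: "integrable Q (\<lambda>x. f x powr \<alpha>)"
    by (rule integrableI_nonneg) (use le in \<open>auto intro: le_less_trans\<close>)
  have bound: "(\<integral>x. f x powr \<alpha> \<partial>Q) \<le> c powr \<alpha>"
    using le by (subst (asm) nn_integral_eq_integral[OF intf]) auto
  fix h :: "_ \<Rightarrow> real"
  assume h[measurable]: "h \<in> borel_measurable Q" and bd: "\<forall>x\<in>space Q. 0 \<le> h x \<and> h x \<le> 1"
  define \<beta> where "\<beta> = \<alpha> / (\<alpha> - 1)"
  define J where "J = (\<integral>x. h x powr \<beta> \<partial>Q)"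
  have \<beta>: "1 < \<beta>" "1 / \<alpha> + 1 / \<beta> = 1" "1 - 1 / \<alpha> = 1 / \<beta>" using \<alpha> by (auto simp: \<beta>_def field_simps)
  have hb: "0 \<le> h x powr \<beta> \<and> h x powr \<beta> \<le> 1" if "x \<in> space Q" for x
    using bd that \<beta> by (auto intro!: powr_le1)
  have J0: "0 \<le> J" and hint: "integrable Q (\<lambda>x. h x powr \<beta>)"
    unfolding J_def using Q.integral_in_unit_interval[of "\<lambda>x. h x powr \<beta>"] hb by auto
  have eq: "integral\<^sup>L P h = (\<integral>x. f x * h x \<partial>Q)"
    unfolding P by (subst integral_density) (use f0 in \<open>auto\<close>)
  have fh: "integrable Q (\<lambda>x. f x * h x)"
    by (rule Bochner_Integration.integrable_bound[OF fin]) (use f0 bd in \<open>auto simp: abs_mult mult_left_le intro!: AE_I2\<close>)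
  have "(\<integral>x. f x * h x \<partial>Q) \<le> c * J powr (1 / \<beta>)"
  \<comment> \<open>Division by the norm of h fails when it is 0; in that case h vanishes almost
    everywhere.\<close>
  proof (cases "J = 0")
    case True
    then have "AE x in Q. h x powr \<beta> = 0" unfolding J_def
      by (subst (asm) integral_nonneg_eq_0_iff_AE) (use hint in auto)
    then have "(\<integral>x. f x * h x \<partial>Q) = (\<integral>x. 0 \<partial>Q)"
      by (intro integral_cong_AE) auto
    then show ?thesis using True by simp
  next
    case False
    then have J: "0 < J" using J0 by simp
    define r where "r = J powr (1 / \<beta>)"
    have r: "0 < r" "r powr \<beta> = J" using J \<beta> by (auto simp: r_def powr_powr)
    have cr: "0 < c * r" using c r by simp
    have "(\<integral>x. f x * h x \<partial>Q) = c * r * (\<integral>x. (f x / c) * (h x / r) \<partial>Q)"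
      using c r by simp
    also have "(\<integral>x. (f x / c) * (h x / r) \<partial>Q) \<le> (\<integral>x. f x powr \<alpha> / (c powr \<alpha>) / \<alpha> + h x powr \<beta> / J / \<beta> \<partial>Q)"
    proof (rule integral_mono)
      show "integrable Q (\<lambda>x. f x / c * (h x / r))" using fh by simp
      show "integrable Q (\<lambda>x. f x powr \<alpha> / (c powr \<alpha>) / \<alpha> + h x powr \<beta> / J / \<beta>)"
        using intf hint by simp
      fix x assume x: "x \<in> space Q"
      show "f x / c * (h x / r) \<le> f x powr \<alpha> / (c powr \<alpha>) / \<alpha> + h x powr \<beta> / J / \<beta>"
        using Youngs_inequality[OF \<alpha> \<beta>(1,2), of "f x / c" "h x / r"] f0[OF x] bd x c r
        by (simp add: powr_divide)
    qed
    also have "\<dots> = (\<integral>x. f x powr \<alpha> \<partial>Q) / (c powr \<alpha>) / \<alpha> + J / J / \<beta>"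
      using intf hint by (simp add: J_def)
    also have "\<dots> \<le> 1 / \<alpha> + 1 / \<beta>"
      using bound c \<alpha> J \<beta>(1) by (intro add_mono divide_right_mono) (auto simp: divide_le_eq_1)
    also have "\<dots> = 1" by (fact \<beta>)
    finally show ?thesis unfolding r_def using cr by (simp add: r_def mult_left_mono)
  qed
  then show "integral\<^sup>L P h \<le> c * (\<integral>x. h x powr (\<alpha> / (\<alpha> - 1)) \<partial>Q) powr (1 - 1 / \<alpha>)"
    unfolding eq \<beta>(3) by (simp only: J_def \<beta>_def)
qed

section \<open>Consequences of a dual bound: Renyi divergence and approximate differential
  privacy\<close>

lemma renyi_bounded_imp_abs_continuous:
  assumes b: "renyi_bounded \<alpha> c P Q" and \<alpha>: "1 < \<alpha>" and P: "prob_space P" and Q: "prob_space Q"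
  shows "absolutely_continuous Q P"
  unfolding absolutely_continuous_def
proof
  interpret P: prob_space P by fact
  interpret Q: prob_space Q by fact
  have s: "sets P = sets Q" using b by (simp add: renyi_bounded_def)
  fix A assume A: "A \<in> null_sets Q"
  then have [measurable]: "A \<in> sets Q" "A \<in> sets P" using s by auto
  \<comment> \<open>The indicator of a Q-null set has \<beta>-norm 0 under Q, so the right side
    vanishes.\<close>
  have "measure P A \<le> c * (\<integral>x. indicator A x powr (\<alpha> / (\<alpha> - 1)) \<partial>Q) powr (1 - 1 / \<alpha>)"
    using renyi_boundedD[OF b, of "indicator A"] by simp
  also have "(\<integral>x. indicator A x powr (\<alpha> / (\<alpha> - 1)) \<partial>Q) = (\<integral>x. indicator A x \<partial>Q :: real)"
    by (intro Bochner_Integration.integral_cong) (auto simp: indicator_def)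
  also have "\<dots> = 0" using A by (simp add: measure_def null_setsD1)
  finally have "measure P A = 0" using \<alpha> by (simp add: measure_le_0_iff)
  then show "A \<in> null_sets P" by (simp add: null_sets_def P.emeasure_eq_measure)
qed

text \<open>Equality in Hoelder's inequality occurs for h proportional to (dP/dQ)^(\<alpha> - 1).
  Truncating dP/dQ at n and dividing by n brings this function into [0,1]. The resulting bound on
  the truncated moment is uniform in n, so monotone convergence removes the truncation.\<close>

lemma renyi_bounded_imp_renyi_divergence:
  assumes b: "renyi_bounded \<alpha> (exp ((\<alpha> - 1) * \<rho>)) P Q"
    and \<alpha>: "1 < \<alpha>" and P: "prob_space P" and Q: "prob_space Q" and \<rho>: "0 \<le> \<rho>"
  shows "renyi_divergence \<alpha> P Q \<le> ereal (\<alpha> * \<rho>)"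
proof -
  interpret P: prob_space P by fact
  interpret Q: prob_space Q by fact
  have s: "sets P = sets Q" using b by (simp add: renyi_bounded_def)
  have ac: "absolutely_continuous Q P"
    by (rule renyi_bounded_imp_abs_continuous[OF b \<alpha> P Q])
  define c where "c = exp ((\<alpha> - 1) * \<rho>)"
  have c: "0 < c" by (simp add: c_def)
  define f where "f = (\<lambda>x. enn2real (RN_deriv Q P x))"
  have [measurable]: "f \<in> borel_measurable Q" unfolding f_def by measurable
  have f0: "0 \<le> f x" for x by (simp add: f_def)
  have "AE x in Q. RN_deriv Q P x \<noteq> \<infinity>"
    by (rule Q.RN_deriv_finite[OF P.sigma_finite_measure_axioms ac s])
  then have "AE x in Q. RN_deriv Q P x = ennreal (f x)"
    by (auto simp: f_def less_top)
  then have Pd: "P = density Q (\<lambda>x. ennreal (f x))"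
    using Q.density_RN_deriv[OF ac s] density_cong[of "RN_deriv Q P" Q "\<lambda>x. ennreal (f x)"] by auto
  have trunc: "(\<integral>\<^sup>+x. ennreal ((min (f x) (real n)) powr \<alpha>) \<partial>Q) \<le> ennreal (c powr \<alpha>)" if n: "0 < n" for n :: nat
  proof -
    define m where "m = (\<lambda>x. min (f x) (real n))"
    have [measurable]: "m \<in> borel_measurable Q" unfolding m_def by measurable
    have m: "0 \<le> m x" "m x \<le> real n" "m x \<le> f x" for x using f0 by (auto simp: m_def)
    \<comment> \<open>With this choice both sides of the dual bound reduce to J: h^\<beta> equals
      (m/n)^\<alpha>, and f * h dominates m * h = n * (m/n)^\<alpha>. Hence n * J \<le> c * J^(1 -
      1/\<alpha>), which solves to n^\<alpha> * J \<le> c^\<alpha>, and n^\<alpha> * J is the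
      truncated moment.\<close>
    define h where "h = (\<lambda>x. (m x / n) powr (\<alpha> - 1))"
    have [measurable]: "h \<in> borel_measurable Q" unfolding h_def by measurable
    have h: "0 \<le> h x" "h x \<le> 1" for x
      using m[of x] n \<alpha> unfolding h_def by (auto intro!: powr_le1)
    define J where "J = (\<integral>x. (m x / n) powr \<alpha> \<partial>Q)"
    have mn: "0 \<le> (m x / n) powr \<alpha>" "(m x / n) powr \<alpha> \<le> 1" for x
      using m[of x] n \<alpha> by (auto intro!: powr_le1)
    have Ji: "integrable Q (\<lambda>x. (m x / n) powr \<alpha>)" "0 \<le> J"
      unfolding J_def by (rule Q.integral_in_unit_interval; use mn in auto)+
    have hi: "integrable P h"
      by (rule P.integral_in_unit_interval) (use h s in \<open>auto cong: measurable_cong_sets\<close>)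
    then have fhi: "integrable Q (\<lambda>x. f x * h x)"
      using f0 unfolding Pd by (subst (asm) integrable_density) auto
    have "n * J = (\<integral>x. n * (m x / n) powr \<alpha> \<partial>Q)" unfolding J_def by simp
    also have "\<dots> \<le> (\<integral>x. f x * h x \<partial>Q)"
    proof (rule integral_mono)
      show "integrable Q (\<lambda>x. n * (m x / n) powr \<alpha>)" using Ji by simp
      show "integrable Q (\<lambda>x. f x * h x)" by fact
      fix x
      have "n * (m x / n) powr \<alpha> = m x * h x"
      proof (cases "m x = 0")
        case False
        then have "0 < m x / n" using m(1)[of x] n by simp
        then have "(m x / n) powr \<alpha> = (m x / n) * h x"
          unfolding h_def using \<open>0 < m x / n\<close> m(1)[of x] False by (simp add: powr_diff)
        then show ?thesis using n by simp
      qed simp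
      also have "\<dots> \<le> f x * h x" using m h by (intro mult_right_mono) auto
      finally show "n * (m x / n) powr \<alpha> \<le> f x * h x" .
    qed
    also have "\<dots> = integral\<^sup>L P h"
      unfolding Pd by (subst integral_density) (use f0 in auto)
    also have "\<dots> \<le> c * (\<integral>x. h x powr (\<alpha> / (\<alpha> - 1)) \<partial>Q) powr (1 - 1 / \<alpha>)"
      unfolding c_def by (rule renyi_boundedD[OF b]) (use h in auto)
    also have "(\<integral>x. h x powr (\<alpha> / (\<alpha> - 1)) \<partial>Q) = J"
      unfolding J_def h_def using \<alpha> by (intro Bochner_Integration.integral_cong) (auto simp: powr_powr)
    finally have nJ: "n * J \<le> c * J powr (1 - 1 / \<alpha>)" .
    have "real n powr \<alpha> * J \<le> c powr \<alpha>"
    proof (cases "J = 0")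
      case False
      then have J: "0 < J" using Ji by simp
      have "n * J powr (1 / \<alpha>) * J powr (1 - 1 / \<alpha>) = n * J"
        using J by (simp add: powr_add[symmetric])
      then have "n * J powr (1 / \<alpha>) * J powr (1 - 1 / \<alpha>) \<le> c * J powr (1 - 1 / \<alpha>)"
        using nJ by (simp only:)
      then have "n * J powr (1 / \<alpha>) \<le> c"
        using J by (simp add: mult_le_cancel_right)
      then have "(n * J powr (1 / \<alpha>)) powr \<alpha> \<le> c powr \<alpha>"
        using \<alpha> by (intro powr_mono2) auto
      then show ?thesis using J \<alpha> by (simp add: powr_mult powr_powr)
    qed simp
    moreover have "(\<integral>\<^sup>+x. ennreal (m x powr \<alpha>) \<partial>Q) = ennreal (real n powr \<alpha> * J)"
    proof -
      have "m x powr \<alpha> = real n powr \<alpha> * (m x / n) powr \<alpha>" for x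
        using m n by (simp add: powr_divide)
      then have "(\<integral>\<^sup>+x. ennreal (m x powr \<alpha>) \<partial>Q) = (\<integral>\<^sup>+x. ennreal (real n powr \<alpha> * (m x / n) powr \<alpha>) \<partial>Q)"
        by simp
      also have "\<dots> = ennreal (\<integral>x. real n powr \<alpha> * (m x / n) powr \<alpha> \<partial>Q)"
        by (rule nn_integral_eq_integral) (use Ji in auto)
      finally show ?thesis by (simp add: J_def)
    qed
    ultimately show ?thesis unfolding m_def by (simp add: ennreal_leI)
  qed
  define I where "I = (\<integral>\<^sup>+ x. ennreal (f x powr \<alpha>) \<partial>Q)"
  \<comment> \<open>The levels are \<open>Suc n\<close> because \<open>trunc\<close> divides by the
    level.\<close>
  have "I = (\<integral>\<^sup>+ x. (SUP n. ennreal (min (f x) (real (Suc n)) powr \<alpha>)) \<partial>Q)"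
    unfolding I_def
  proof (rule nn_integral_cong)
    fix x
    obtain N :: nat where N: "f x \<le> N" using real_arch_simple by blast
    show "ennreal (f x powr \<alpha>) = (SUP n. ennreal (min (f x) (real (Suc n)) powr \<alpha>))"
    proof (rule antisym)
      have "ennreal (f x powr \<alpha>) = ennreal (min (f x) (real (Suc N)) powr \<alpha>)" using N by (simp add: min_def)
      also have "\<dots> \<le> (SUP n. ennreal (min (f x) (real (Suc n)) powr \<alpha>))" by (rule SUP_upper) simp
      finally show "ennreal (f x powr \<alpha>) \<le> (SUP n. ennreal (min (f x) (real (Suc n)) powr \<alpha>))" .
      show "(SUP n. ennreal (min (f x) (real (Suc n)) powr \<alpha>)) \<le> ennreal (f x powr \<alpha>)"
        using f0[of x] \<alpha> by (intro SUP_least ennreal_leI powr_mono2) auto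
    qed
  qed
  also have "\<dots> = (SUP n. \<integral>\<^sup>+ x. ennreal (min (f x) (real (Suc n)) powr \<alpha>) \<partial>Q)"
  proof (rule nn_integral_monotone_convergence_SUP)
    show "incseq (\<lambda>n x. ennreal (min (f x) (real (Suc n)) powr \<alpha>))"
      using f0 \<alpha> by (intro monoI le_funI ennreal_leI powr_mono2) (auto simp: min_le_iff_disj)
  qed measurable
  also have "\<dots> \<le> ennreal (c powr \<alpha>)"
    by (intro SUP_least trunc) simp
  finally have I: "I \<le> ennreal (c powr \<alpha>)" .
  then have fin: "I \<noteq> \<infinity>" by (auto simp: top_unique)
  have "ln (enn2real I) / (\<alpha> - 1) \<le> \<alpha> * \<rho>"
  \<comment> \<open>Here \<open>ln\<close> takes its default value 0 at 0, so the bound is just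
    nonnegativity of \<alpha> * \<rho>.\<close>
  proof (cases "enn2real I = 0")
    case True
    then show ?thesis using \<alpha> \<rho> by simp
  next
    case False
    then have "0 < enn2real I" using enn2real_nonneg[of I] by linarith
    moreover have "enn2real I \<le> c powr \<alpha>" using enn2real_mono[OF I] by simp
    ultimately have "ln (enn2real I) \<le> ln (c powr \<alpha>)"
      using c by (subst ln_le_cancel_iff) auto
    also have "\<dots> = \<alpha> * ((\<alpha> - 1) * \<rho>)" by (simp add: c_def ln_powr)
    finally show ?thesis using \<alpha> by (simp add: field_simps)
  qed
  then show ?thesis
    using s ac fin unfolding renyi_divergence_def Let_def I_def f_def by simp
qed

text \<open>Tested on the indicator of S, the dual bound is exactly the geometric mean, with weights
  1 - 1/\<alpha> and 1/\<alpha>, of the two summands on the right; a weighted geometric mean is at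
  most the maximum, hence at most the sum. No tail bound for the privacy loss is required.\<close>

lemma renyi_bounded_imp_DP_ineq:
  assumes b: "renyi_bounded \<alpha> (exp ((\<alpha> - 1) * \<rho>)) P Q"
    and \<alpha>: "1 < \<alpha>" and P: "prob_space P" and Q: "prob_space Q" and S: "S \<in> sets P"
  shows "measure P S \<le> exp \<epsilon> * measure Q S + exp ((\<alpha> - 1) * (\<alpha> * \<rho> - \<epsilon>))"
proof -
  interpret P: prob_space P by fact
  interpret Q: prob_space Q by fact
  have s: "sets P = sets Q" using b by (simp add: renyi_bounded_def)
  have [measurable]: "S \<in> sets Q" using s S by simp
  define q where "q = measure Q S"
  have "measure P S \<le> exp ((\<alpha> - 1) * \<rho>) * (\<integral>x. indicator S x powr (\<alpha> / (\<alpha> - 1)) \<partial>Q) powr (1 - 1 / \<alpha>)"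
    using renyi_boundedD[OF b, of "indicator S"] S by simp
  also have "(\<integral>x. indicator S x powr (\<alpha> / (\<alpha> - 1)) \<partial>Q) = (\<integral>x. indicator S x \<partial>Q :: real)"
    by (intro Bochner_Integration.integral_cong) (auto simp: indicator_def)
  also have "\<dots> = q" by (simp add: q_def)
  also have "exp ((\<alpha> - 1) * \<rho>) * q powr (1 - 1 / \<alpha>)
      = (exp \<epsilon> * q) powr (1 - 1 / \<alpha>) * exp ((\<alpha> - 1) * (\<alpha> * \<rho> - \<epsilon>)) powr (1 / \<alpha>)"
  proof -
    have "exp \<epsilon> powr (1 - 1 / \<alpha>) * exp ((\<alpha> - 1) * (\<alpha> * \<rho> - \<epsilon>)) powr (1 / \<alpha>) 
       = exp (\<epsilon> * (1 - 1 / \<alpha>) + (\<alpha> - 1) * (\<alpha> * \<rho> - \<epsilon>) * (1 / \<alpha>))"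
      by (simp add: exp_powr_real exp_add)
    also have "\<epsilon> * (1 - 1 / \<alpha>) + (\<alpha> - 1) * (\<alpha> * \<rho> - \<epsilon>) * (1 / \<alpha>) = (\<alpha> - 1) * \<rho>"
      using \<alpha> by (simp add: field_simps)
    finally show ?thesis by (simp add: powr_mult q_def mult_ac)
  qed
  also have "\<dots> \<le> exp \<epsilon> * q + exp ((\<alpha> - 1) * (\<alpha> * \<rho> - \<epsilon>))" (is "?x powr _ * ?y powr _ \<le> _")
  proof -
    have xy: "0 \<le> ?x" "0 < ?y" by (simp_all add: q_def)
    have "?x powr (1 - 1 / \<alpha>) * ?y powr (1 / \<alpha>)
        \<le> (max ?x ?y) powr (1 - 1 / \<alpha>) * (max ?x ?y) powr (1 / \<alpha>)"
      using \<alpha> xy by (intro mult_mono powr_mono2) auto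
    also have "\<dots> = max ?x ?y" using xy by (simp add: powr_add[symmetric])
    also have "\<dots> \<le> ?x + ?y" using xy by simp
    finally show ?thesis .
  qed
  finally show ?thesis by (simp add: q_def)
qed

section \<open>Pure differential privacy implies zCDP\<close>

text \<open>The cumulant generating function ln F vanishes at 0 and 1 and has second derivative at most
  \<epsilon>^2, so G below is convex with zeros at 0 and 1 and hence nonnegative at \<alpha> > 1.\<close>
lemma exp_moment_bound:
  fixes q z :: "'i \<Rightarrow> real"
  assumes A: "finite A" and q: "\<And>j. j \<in> A \<Longrightarrow> 0 < q j" and z: "\<And>j. j \<in> A \<Longrightarrow> \<bar>z j\<bar> \<le> \<epsilon>"
    and F0: "(\<Sum>j\<in>A. q j) = 1" and F1: "(\<Sum>j\<in>A. q j * exp (z j)) = 1" and \<alpha>: "1 < \<alpha>"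
  shows "(\<Sum>j\<in>A. q j * exp (\<alpha> * z j)) \<le> exp (\<alpha> * (\<alpha> - 1) * \<epsilon>\<^sup>2 / 2)"
proof -
  define F where "F = (\<lambda>t. \<Sum>j\<in>A. q j * exp (t * z j))"
  define F' where "F' = (\<lambda>t. \<Sum>j\<in>A. q j * z j * exp (t * z j))"
  define F'' where "F'' = (\<lambda>t. \<Sum>j\<in>A. q j * (z j)\<^sup>2 * exp (t * z j))"
  have "A \<noteq> {}" using F0 by auto
  then have F: "0 < F t" for t unfolding F_def using q A by (intro sum_pos) auto
  have dF: "(F has_real_derivative F' t) (at t)" for t
    unfolding F_def F'_def by (auto intro!: derivative_eq_intros sum.cong simp: algebra_simps)
  have dF': "(F' has_real_derivative F'' t) (at t)" for t
    unfolding F'_def F''_def by (auto intro!: derivative_eq_intros sum.cong simp: algebra_simps power2_eq_square)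
  have F'': "F'' t \<le> \<epsilon>\<^sup>2 * F t" for t
    unfolding F''_def F_def sum_distrib_left
  proof (rule sum_mono)
    fix j assume j: "j \<in> A"
    have "(z j)\<^sup>2 \<le> \<epsilon>\<^sup>2" using z[OF j] by (simp add: abs_le_square_iff[symmetric])
    then have "(q j * exp (t * z j)) * (z j)\<^sup>2 \<le> (q j * exp (t * z j)) * \<epsilon>\<^sup>2"
      using q[OF j] by (intro mult_left_mono) auto
    then show "q j * (z j)\<^sup>2 * exp (t * z j) \<le> \<epsilon>\<^sup>2 * (q j * exp (t * z j))" by (simp add: mult_ac)
  qed
  define G where "G = (\<lambda>t. \<epsilon>\<^sup>2 * (t * (t - 1)) / 2 - ln (F t))"
  define G' where "G' = (\<lambda>t. \<epsilon>\<^sup>2 * (2 * t - 1) / 2 - F' t / F t)"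
  define G'' where "G'' = (\<lambda>t. \<epsilon>\<^sup>2 - (F'' t * F t - F' t * F' t) / (F t * F t))"
  have dG: "(G has_real_derivative G' t) (at t)" for t
    unfolding G_def G'_def using F[of t]
    by (auto intro!: derivative_eq_intros dF simp: field_simps)
  have dG': "(G' has_real_derivative G'' t) (at t)" for t
    unfolding G'_def G''_def using F[of t]
    by (auto intro!: derivative_eq_intros dF dF' simp: field_simps)
  have G'': "0 \<le> G'' t" for t
  proof -
    \<comment> \<open>The fraction is the variance of z under the law tilted by exp (t * z);
      dropping the squared mean leaves the second moment, which is at most
      \<open>\<epsilon>\<^sup>2\<close>.\<close>
    have "(F'' t * F t - F' t * F' t) / (F t * F t) \<le> (F'' t * F t) / (F t * F t)"
      using F[of t] by (intro divide_right_mono) auto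
    also have "\<dots> \<le> \<epsilon>\<^sup>2" using F''[of t] F[of t] by (simp add: field_simps)
    finally show ?thesis by (simp add: G''_def)
  qed
  have "convex_on UNIV G"
    by (rule f''_ge0_imp_convex) (use dG dG' G'' in auto)
  \<comment> \<open>The convex combination is the point 1, so 0 = G 1 \<le> G \<alpha> /
    \<alpha>.\<close>
  then have "G ((1 - 1 / \<alpha>) *\<^sub>R 0 + (1 / \<alpha>) *\<^sub>R \<alpha>) \<le> (1 - 1 / \<alpha>) * G 0 + 1 / \<alpha> * G \<alpha>"
    by (rule convex_onD) (use \<alpha> in auto)
  moreover have "G 0 = 0" "G 1 = 0" using F0 F1 by (simp_all add: G_def F_def)
  ultimately have "0 \<le> G \<alpha>" using \<alpha> by (simp add: zero_le_divide_iff)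
  then have "ln (F \<alpha>) \<le> \<alpha> * (\<alpha> - 1) * \<epsilon>\<^sup>2 / 2" by (simp add: G_def algebra_simps)
  then have "F \<alpha> \<le> exp (\<alpha> * (\<alpha> - 1) * \<epsilon>\<^sup>2 / 2)" using F[of \<alpha>] by (metis exp_le_cancel_iff exp_ln)
  then show ?thesis by (simp add: F_def)
qed

lemma nn_integral_finite_support:
  assumes s: "sets M = UNIV" and A: "finite A" and sup: "AE x in M. x \<in> A"
  shows "(\<integral>\<^sup>+x. g x \<partial>M) = (\<Sum>x\<in>A. g x * emeasure M {x})"
proof -
  have [measurable]: "f \<in> M \<rightarrow>\<^sub>M borel" for f :: "_ \<Rightarrow> ennreal"
    using s by (auto simp: measurable_def)
  have [measurable]: "X \<in> sets M" for X using s by simp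
  have "(\<integral>\<^sup>+x. g x \<partial>M) = (\<integral>\<^sup>+x. (\<Sum>y\<in>A. g y * indicator {y} x) \<partial>M)"
    by (rule nn_integral_cong_AE) (use sup A in \<open>auto simp: indicator_def sum.delta\<close>)
  also have "\<dots> = (\<Sum>y\<in>A. g y * emeasure M {y})"
    by (subst nn_integral_sum) (auto simp: nn_integral_cmult_indicator)
  finally show ?thesis .
qed

text \<open>The two inequalities together confine the log ratio of the atoms to
  [-\<epsilon>, \<epsilon>], which is the hypothesis of \<open>exp_moment_bound\<close>; on a finite
  support, atoms determine everything.\<close>

lemma pure_DP_renyi_bounded:
  fixes P Q :: "'i::countable measure"
  assumes \<alpha>: "1 < \<alpha>" and s: "sets P = UNIV" "sets Q = UNIV" and prob: "prob_space P" "prob_space Q"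
    and A: "finite A" and supp: "AE x in P. x \<in> A" "AE x in Q. x \<in> A"
    and PQ: "\<And>j. j \<in> A \<Longrightarrow> measure P {j} \<le> exp \<epsilon> * measure Q {j}"
    and QP: "\<And>j. j \<in> A \<Longrightarrow> measure Q {j} \<le> exp \<epsilon> * measure P {j}"
  shows "renyi_bounded \<alpha> (exp ((\<alpha> - 1) * (\<epsilon>\<^sup>2 / 2))) P Q"
proof -
  interpret P: prob_space P by fact
  interpret Q: prob_space Q by fact
  have [measurable]: "X \<in> sets P" "X \<in> sets Q" for X using s by auto
  have spc: "space P = UNIV" "space Q = UNIV" using s sets_eq_imp_space_eq[of P "count_space UNIV"] sets_eq_imp_space_eq[of Q "count_space UNIV"]
    by auto
  have meas: "f \<in> borel_measurable Q" for f :: "_ \<Rightarrow> real"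
    using s spc by (auto simp: measurable_def)
  have meas': "f \<in> borel_measurable Q" for f :: "_ \<Rightarrow> ennreal"
    using s spc by (auto simp: measurable_def)
  define p where "p j = measure P {j}" for j
  define q where "q j = measure Q {j}" for j
  \<comment> \<open>The default 0 is harmless: where q vanishes, \<open>PQ\<close> forces p to
    vanish as well, so f is still a density of P.\<close>
  define f where "f j = (if q j = 0 then 0 else p j / q j)" for j
  have p0: "0 \<le> p j" and q0: "0 \<le> q j" for j by (auto simp: p_def q_def)
  have zero: "p j = 0 \<and> q j = 0" if "j \<notin> A" for j
  proof -
    have "AE x in P. x \<notin> {j}" "AE x in Q. x \<notin> {j}" using supp that by auto
    then show ?thesis by (simp add: p_def q_def P.prob_eq_0 Q.prob_eq_0)
  qed
  have fq: "f j * q j = p j" for j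
    using PQ[of j] zero[of j] p0[of j] by (cases "j \<in> A") (auto simp: f_def p_def q_def measure_le_0_iff)
  \<comment> \<open>On B both weights are positive, so \<open>ln (f j)\<close> is a genuine log
    ratio and no default value of \<open>ln\<close> enters the sum.\<close>
  define B where "B = {j\<in>A. 0 < q j}"
  have B: "finite B" using A by (simp add: B_def)
  have notB: "j \<in> A - B \<Longrightarrow> q j = 0 \<and> p j = 0" for j using q0[of j] fq[of j] by (auto simp: B_def)
  have pB: "0 < p j" if "j \<in> B" for j
  proof -
    have "0 < exp \<epsilon> * p j" using that QP[of j] by (auto simp: B_def p_def q_def)
    then show ?thesis by (simp add: zero_less_mult_iff)
  qed
  have one: "(\<Sum>j\<in>B. q j) = 1" "(\<Sum>j\<in>B. p j) = 1"
  proof -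
    have "measure P A = 1" "measure Q A = 1" using supp by (simp_all add: P.prob_eq_1 Q.prob_eq_1)
    moreover have "measure P A = (\<Sum>j\<in>A. p j)" "measure Q A = (\<Sum>j\<in>A. q j)"
      unfolding p_def q_def using A by (auto intro!: P.finite_measure_eq_sum_singleton Q.finite_measure_eq_sum_singleton)
    moreover have "(\<Sum>j\<in>A. q j) = (\<Sum>j\<in>B. q j)" "(\<Sum>j\<in>A. p j) = (\<Sum>j\<in>B. p j)"
      using A notB by (auto intro!: sum.mono_neutral_right simp: B_def)
    ultimately show "(\<Sum>j\<in>B. q j) = 1" "(\<Sum>j\<in>B. p j) = 1" by simp_all
  qed
  have z: "\<bar>ln (f j)\<bar> \<le> \<epsilon>" "exp (ln (f j)) = f j" if j: "j \<in> B" for j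
  proof -
    have qj: "0 < q j" "j \<in> A" using j by (auto simp: B_def)
    then have fj: "f j = p j / q j" "0 < f j" using pB[OF j] by (auto simp: f_def)
    have "f j \<le> exp \<epsilon>" using PQ[OF qj(2)] qj by (simp add: fj p_def q_def field_simps)
    moreover have "exp (- \<epsilon>) \<le> f j" using QP[OF qj(2)] qj by (simp add: fj p_def q_def field_simps exp_minus)
    ultimately have "ln (f j) \<le> ln (exp \<epsilon>)" "ln (exp (- \<epsilon>)) \<le> ln (f j)"
      using fj(2) by (simp_all only: ln_le_cancel_iff exp_gt_zero)
    then show "\<bar>ln (f j)\<bar> \<le> \<epsilon>" by (simp add: abs_le_iff)
    show "exp (ln (f j)) = f j" using fj by simp
  qed
  have "(\<Sum>j\<in>B. q j * exp (\<alpha> * ln (f j))) \<le> exp (\<alpha> * (\<alpha> - 1) * \<epsilon>\<^sup>2 / 2)"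
  proof (rule exp_moment_bound[OF B _ _ one(1) _ \<alpha>])
    show "(\<Sum>j\<in>B. q j * exp (ln (f j))) = 1"
      using one(2) fq z(2) by (simp add: mult.commute)
  qed (use z in \<open>auto simp: B_def\<close>)
  also have "(\<Sum>j\<in>B. q j * exp (\<alpha> * ln (f j))) = (\<Sum>j\<in>B. f j powr \<alpha> * q j)"
    using pB by (intro sum.cong refl) (force simp: powr_def f_def B_def)
  also have "\<dots> = (\<Sum>j\<in>A. f j powr \<alpha> * q j)"
    using A notB by (intro sum.mono_neutral_left) (auto simp: B_def)
  finally have sum: "(\<Sum>j\<in>A. f j powr \<alpha> * q j) \<le> exp (\<alpha> * (\<alpha> - 1) * \<epsilon>\<^sup>2 / 2)" .
  show ?thesis
  proof (rule renyi_bounded_density[OF \<alpha> _ prob meas])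
    show "0 \<le> f j" for j using p0 q0 by (simp add: f_def)
    show "P = density Q (\<lambda>x. ennreal (f x))"
    proof (rule measure_eqI_countable[where A=UNIV])
      fix j
      have "emeasure (density Q (\<lambda>x. ennreal (f x))) {j} = (\<integral>\<^sup>+x. ennreal (f j) * indicator {j} x \<partial>Q)"
        by (subst emeasure_density) (auto simp: meas' indicator_def intro!: nn_integral_cong)
      also have "\<dots> = ennreal (f j * q j)"
        using q0 by (subst nn_integral_cmult_indicator)
          (auto simp: Q.emeasure_eq_measure q_def f_def ennreal_mult'')
      also have "\<dots> = emeasure P {j}" using fq by (simp add: P.emeasure_eq_measure p_def)
      finally show "emeasure P {j} = emeasure (density Q (\<lambda>x. ennreal (f x))) {j}" by simp
    qed (use s in auto)
    have "(\<integral>\<^sup>+ x. ennreal (f x powr \<alpha>) \<partial>Q) = ennreal (\<Sum>j\<in>A. f j powr \<alpha> * q j)"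
      by (subst nn_integral_finite_support[OF s(2) A supp(2)])
         (auto simp: Q.emeasure_eq_measure q_def sum_ennreal[symmetric] ennreal_mult' simp del: sum_ennreal)
    also have "\<dots> \<le> ennreal (exp ((\<alpha> - 1) * (\<epsilon>\<^sup>2 / 2)) powr \<alpha>)"
      using sum by (intro ennreal_leI) (simp add: exp_powr_real mult_ac)
    finally show "(\<integral>\<^sup>+ x. ennreal (f x powr \<alpha>) \<partial>Q) \<le> ennreal (exp ((\<alpha> - 1) * (\<epsilon>\<^sup>2 / 2)) powr \<alpha>)" .
  qed simp
qed

section \<open>Gaussian and Laplace noise\<close>

definition gauss_density :: "real \<Rightarrow> 'a::euclidean_space \<Rightarrow> real" where
  "gauss_density s x = (\<Prod>b\<in>Basis. normal_density 0 (sqrt s) (x \<bullet> b))"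

lemma gauss_density_measurable[measurable]: "gauss_density s \<in> borel_measurable borel"
  unfolding gauss_density_def[abs_def] by measurable

lemma gauss_density_pos: "0 < s \<Longrightarrow> 0 < gauss_density s x"
  unfolding gauss_density_def by (intro prod_pos) (auto intro!: normal_density_pos)

text \<open>The normalising constant appears only as the value at 0, so it cancels from density
  ratios without being evaluated.\<close>

lemma gauss_density_eq:
  fixes x :: "'a::euclidean_space"
  assumes s: "0 < s"
  shows "gauss_density s x = gauss_density s (0::'a) * exp (- (norm x)\<^sup>2 / (2 * s))"
proof -
  have n: "(norm x)\<^sup>2 = (\<Sum>b\<in>Basis. (x \<bullet> b)\<^sup>2)"
    by (subst power2_norm_eq_inner, subst euclidean_inner) (simp add: power2_eq_square)
  have "gauss_density s x = (\<Prod>b\<in>(Basis::'a set). normal_density 0 (sqrt s) 0 * exp (- (x \<bullet> b)\<^sup>2 / (2 * s)))"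
    unfolding gauss_density_def normal_density_def using s by simp
  also have "\<dots> = gauss_density s (0::'a) * exp (\<Sum>b\<in>Basis. - (x \<bullet> b)\<^sup>2 / (2 * s))"
    by (simp add: prod.distrib gauss_density_def exp_sum)
  also have "(\<Sum>b\<in>Basis. - (x \<bullet> b)\<^sup>2 / (2 * s)) = - (norm x)\<^sup>2 / (2 * s)"
    by (simp add: n sum_negf sum_divide_distrib)
  finally show ?thesis .
qed

lemma nn_integral_lborel_translate:
  fixes a :: "'a::euclidean_space"
  assumes [measurable]: "f \<in> borel_measurable borel"
  shows "(\<integral>\<^sup>+x. f (a + x) \<partial>lborel) = (\<integral>\<^sup>+x. f x \<partial>lborel)"
  by (subst (2) lborel_distr_plus[of a, symmetric]) (simp add: nn_integral_distr)

lemma nn_integral_gauss_density: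
  fixes a :: "'a::euclidean_space"
  assumes s: "0 < s"
  shows "(\<integral>\<^sup>+x. ennreal (gauss_density s (x - a)) \<partial>lborel) = 1"
proof -
  have "(\<integral>\<^sup>+x. ennreal (gauss_density s (x - a)) \<partial>lborel) = (\<integral>\<^sup>+x. ennreal (gauss_density s (x::'a)) \<partial>lborel)"
    using nn_integral_lborel_translate[of "\<lambda>x. ennreal (gauss_density s x)" "-a"] by simp
  also have "\<dots> = (\<integral>\<^sup>+x. (\<Prod>b\<in>(Basis::'a set). ennreal (normal_density 0 (sqrt s) (x \<bullet> b))) \<partial>lborel)"
    by (simp add: gauss_density_def prod_ennreal)
  also have "\<dots> = (\<Prod>b\<in>(Basis::'a set). \<integral>\<^sup>+x. ennreal (normal_density 0 (sqrt s) x) \<partial>lborel)"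
    by (rule nn_integral_lborel_prod) auto
  also have "(\<integral>\<^sup>+x. ennreal (normal_density 0 (sqrt s) x) \<partial>lborel) = 1"
    using s by (subst nn_integral_eq_integral) auto
  finally show ?thesis by simp
qed

lemma gauss_vec_eq: "gauss_vec s = density lborel (\<lambda>x. ennreal (gauss_density s x))"
  by (simp add: gauss_vec_def gauss_density_def)

lemma sets_gauss_vec[simp, measurable_cong]: "sets (gauss_vec s) = sets borel"
  by (simp add: gauss_vec_def)

lemma space_gauss_vec[simp]: "space (gauss_vec s) = UNIV"
  by (simp add: gauss_vec_def)

lemma prob_space_gauss_vec: "0 < s \<Longrightarrow> prob_space (gauss_vec s)"
  unfolding gauss_vec_eq using nn_integral_gauss_density[of s 0]
  by (intro prob_spaceI) (simp add: emeasure_density)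

lemma distr_gauss_vec:
  "distr (gauss_vec s) borel (\<lambda>z. a + z) = density lborel (\<lambda>x. ennreal (gauss_density s (x - a)))"
proof (rule measure_eqI)
  fix A assume "A \<in> sets (distr (gauss_vec s) borel (\<lambda>z. a + z))"
  then have [measurable]: "A \<in> sets borel" by simp
  have "emeasure (distr (gauss_vec s) borel (\<lambda>z. a + z)) A
      = (\<integral>\<^sup>+x. indicator A x \<partial>distr (gauss_vec s) borel (\<lambda>z. a + z))" by simp
  also have "\<dots> = (\<integral>\<^sup>+z. indicator A (a + z) \<partial>gauss_vec s)" 
    by (rule nn_integral_distr) auto
  also have "\<dots> = (\<integral>\<^sup>+z. ennreal (gauss_density s z) * indicator A (a + z) \<partial>lborel)"
    unfolding gauss_vec_eq by (rule nn_integral_density) auto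
  also have "\<dots> = (\<integral>\<^sup>+x. ennreal (gauss_density s (x - a)) * indicator A x \<partial>lborel)"
    using nn_integral_lborel_translate[of "\<lambda>x. ennreal (gauss_density s (x - a)) * indicator A x" a] by simp
  also have "\<dots> = emeasure (density lborel (\<lambda>x. ennreal (gauss_density s (x - a)))) A"
    by (simp add: emeasure_density)
  finally show "emeasure (distr (gauss_vec s) borel (\<lambda>z. a + z)) A =
     emeasure (density lborel (\<lambda>x. ennreal (gauss_density s (x - a)))) A" .
qed simp

text \<open>The quantity |a - b|^2 / (2 * s) is the zCDP parameter of Gaussian noise of variance s:
  the \<alpha>-moment of the density ratio is exp (\<alpha> * (\<alpha> - 1) * |a - b|^2 / (2 * s))
  in every dimension.\<close>

lemma gauss_vec_renyi_bounded:
  fixes a b :: "'a::euclidean_space"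
  assumes \<alpha>: "1 < \<alpha>" and s: "0 < s" and ab: "(norm (a - b))\<^sup>2 \<le> 2 * s * \<rho>"
  shows "renyi_bounded \<alpha> (exp ((\<alpha> - 1) * \<rho>))
     (distr (gauss_vec s) borel (\<lambda>z. a + z)) (distr (gauss_vec s) borel (\<lambda>z. b + z))"
    (is "renyi_bounded _ _ ?P ?Q")
proof (rule renyi_bounded_density[OF \<alpha>])
  let ?f = "\<lambda>x. gauss_density s (x - a) / gauss_density s (x - b)"
  interpret G: prob_space "gauss_vec s :: 'a measure" by (rule prob_space_gauss_vec[OF s])
  show "prob_space ?P" "prob_space ?Q" by (auto intro!: G.prob_space_distr)
  show "?f \<in> borel_measurable ?Q" by measurable
  note pos = gauss_density_pos[OF s]
  show "0 \<le> ?f x" for x by (intro divide_nonneg_nonneg less_imp_le[OF pos])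
  show "?P = density ?Q (\<lambda>x. ennreal (?f x))"
  proof -
    have "ennreal (gauss_density s (x - a)) = ennreal (gauss_density s (x - b)) * ennreal (?f x)" for x
      using pos[of "x - a"] pos[of "x - b"] by (simp add: ennreal_mult''[symmetric])
    then show ?thesis unfolding distr_gauss_vec by (subst density_density_eq) auto
  qed
  \<comment> \<open>Completing the square turns the integrand into a multiple of the Gaussian density centred
    at \<alpha> a + (1 - \<alpha>) b.\<close>
  have le: "ennreal (gauss_density s (x - b)) * ennreal (?f x powr \<alpha>)
       \<le> ennreal (exp ((\<alpha> - 1) * \<rho>) powr \<alpha>) * ennreal (gauss_density s (x - (\<alpha> *\<^sub>R a + (1 - \<alpha>) *\<^sub>R b)))" for x
  proof -
    define u where "u = x - b"
    define v where "v = a - b"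
    define g where "g = gauss_density s (0::'a)"
    have g: "0 < g" unfolding g_def by (rule pos)
    have e: "x - a = u - v" "x - (\<alpha> *\<^sub>R a + (1 - \<alpha>) *\<^sub>R b) = u - \<alpha> *\<^sub>R v"
      by (simp_all add: u_def v_def algebra_simps)
    have "?f x = exp (- (norm (u - v))\<^sup>2 / (2 * s) - - (norm u)\<^sup>2 / (2 * s))"
    proof -
      have "?f x = g * exp (- (norm (u - v))\<^sup>2 / (2 * s)) / (g * exp (- (norm u)\<^sup>2 / (2 * s)))"
        using gauss_density_eq[OF s, of "u - v"] gauss_density_eq[OF s, of u]
        by (simp only: e(1) g_def flip: u_def)
      also have "\<dots> = exp (- (norm (u - v))\<^sup>2 / (2 * s) - - (norm u)\<^sup>2 / (2 * s))"
        using g by (simp only: exp_diff) simp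
      finally show ?thesis .
    qed
    then have "gauss_density s (x - b) * ?f x powr \<alpha>
        = g * exp (- (norm u)\<^sup>2 / (2 * s) + (- (norm (u - v))\<^sup>2 / (2 * s) - - (norm u)\<^sup>2 / (2 * s)) * \<alpha>)"
      unfolding gauss_density_eq[OF s, of "x - b"] by (simp only: g_def exp_powr_real exp_add mult.assoc flip: u_def)
    also have "- (norm u)\<^sup>2 / (2 * s) + (- (norm (u - v))\<^sup>2 / (2 * s) - - (norm u)\<^sup>2 / (2 * s)) * \<alpha>
        = \<alpha> * (\<alpha> - 1) * ((norm v)\<^sup>2 / (2 * s)) + - (norm (u - \<alpha> *\<^sub>R v))\<^sup>2 / (2 * s)"
    proof -
      have n: "(norm (u - t *\<^sub>R v))\<^sup>2 = (norm u)\<^sup>2 - 2 * t * (u \<bullet> v) + t * t * (norm v)\<^sup>2" for t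
        by (simp add: power2_norm_eq_inner inner_diff_left inner_diff_right inner_commute algebra_simps)
      show ?thesis using s unfolding n[of 1, simplified] n[of \<alpha>] by (simp add: field_simps)
    qed
    also have "g * exp \<dots> = exp (\<alpha> * (\<alpha> - 1) * ((norm v)\<^sup>2 / (2 * s))) * gauss_density s (u - \<alpha> *\<^sub>R v)"
      unfolding gauss_density_eq[OF s, of "u - \<alpha> *\<^sub>R v"] by (simp only: exp_add g_def mult_ac)
    also have "\<dots> \<le> exp (\<alpha> * (\<alpha> - 1) * \<rho>) * gauss_density s (u - \<alpha> *\<^sub>R v)"
    proof (intro mult_right_mono less_imp_le[OF pos])
      have "(norm v)\<^sup>2 / (2 * s) \<le> \<rho>" using ab s by (simp add: v_def field_simps)
      then show "exp (\<alpha> * (\<alpha> - 1) * ((norm v)\<^sup>2 / (2 * s))) \<le> exp (\<alpha> * (\<alpha> - 1) * \<rho>)"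
        unfolding exp_le_cancel_iff by (rule mult_left_mono) (use \<alpha> in simp)
    qed
    also have "exp (\<alpha> * (\<alpha> - 1) * \<rho>) = exp ((\<alpha> - 1) * \<rho>) powr \<alpha>" by (simp add: exp_powr_real mult_ac)
    finally have "gauss_density s (x - b) * ?f x powr \<alpha>
      \<le> exp ((\<alpha> - 1) * \<rho>) powr \<alpha> * gauss_density s (x - (\<alpha> *\<^sub>R a + (1 - \<alpha>) *\<^sub>R b))" unfolding e .
    from ennreal_leI[OF this] show ?thesis
      by (simp only: ennreal_mult'[OF less_imp_le[OF pos]] ennreal_mult'[OF powr_ge_zero])
  qed
  have "(\<integral>\<^sup>+ x. ennreal (?f x powr \<alpha>) \<partial>?Q) = (\<integral>\<^sup>+ x. ennreal (gauss_density s (x - b)) * ennreal (?f x powr \<alpha>) \<partial>lborel)"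
    unfolding distr_gauss_vec by (rule nn_integral_density) measurable
  also have "\<dots> \<le> (\<integral>\<^sup>+ x. ennreal (exp ((\<alpha> - 1) * \<rho>) powr \<alpha>) * ennreal (gauss_density s (x - (\<alpha> *\<^sub>R a + (1 - \<alpha>) *\<^sub>R b))) \<partial>lborel)"
    by (intro nn_integral_mono le)
  also have "\<dots> = ennreal (exp ((\<alpha> - 1) * \<rho>) powr \<alpha>)"
    by (subst nn_integral_cmult) (auto simp: nn_integral_gauss_density[OF s])
  finally show "(\<integral>\<^sup>+ x. ennreal (?f x powr \<alpha>) \<partial>?Q) \<le> ennreal (exp ((\<alpha> - 1) * \<rho>) powr \<alpha>)" .
qed simp

section \<open>Laplace noise\<close>

lemma sets_laplace[simp, measurable_cong]: "sets (laplace b) = sets borel"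
  by (simp add: laplace_def)

lemma space_laplace[simp]: "space (laplace b) = UNIV"
  by (simp add: laplace_def)

text \<open>The Laplace density is the average of an exponential density and its mirror image. At 0
  both halves contribute, so the identity holds only almost everywhere.\<close>

lemma prob_space_laplace:
  assumes b: "0 < b"
  shows "prob_space (laplace b)"
proof (rule prob_spaceI)
  define e where "e = exponential_density (1 / b)"
  have [measurable]: "e \<in> borel_measurable borel" unfolding e_def by measurable
  have e0: "0 \<le> e x" for x using b by (simp add: e_def exponential_density_nonneg)
  have int: "(\<integral>\<^sup>+x. ennreal (e x) \<partial>lborel) = 1"
    using prob_space.emeasure_space_1[OF prob_space_exponential_density[of "1 / b"]] b
    by (simp add: emeasure_density e_def)
  have neg: "(\<integral>\<^sup>+x. ennreal (e (- x)) \<partial>lborel) = 1"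
    using nn_integral_real_affine[of "\<lambda>x. ennreal (e x)" "-1" 0] int by simp
  have "emeasure (laplace b) (space (laplace b)) = (\<integral>\<^sup>+x. ennreal (exp (- \<bar>x\<bar> / b) / (2 * b)) \<partial>lborel)"
    unfolding laplace_def by (simp add: emeasure_density)
  also have "\<dots> = (\<integral>\<^sup>+x. ennreal (1 / 2) * (ennreal (e x) + ennreal (e (- x))) \<partial>lborel)"
  proof (rule nn_integral_cong_AE)
    have "AE x in lborel. x \<noteq> (0::real)" by (rule AE_lborel_singleton)
    then show "AE x in lborel. ennreal (exp (- \<bar>x\<bar> / b) / (2 * b)) = ennreal (1 / 2) * (ennreal (e x) + ennreal (e (- x)))"
    proof eventually_elim
      case (elim x)
      have "exp (- \<bar>x\<bar> / b) / (2 * b) = 1 / 2 * (e x + e (- x))"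
        using elim b by (auto simp: e_def exponential_density_def abs_if)
      moreover have "ennreal (1 / 2 * (e x + e (- x))) = ennreal (1 / 2) * (ennreal (e x) + ennreal (e (- x)))"
        using e0 by (metis add_nonneg_nonneg ennreal_mult'' ennreal_plus)
      ultimately show ?case by (simp only:)
    qed
  qed
  also have "\<dots> = ennreal (1 / 2) * (1 + 1)"
    by (subst nn_integral_cmult) (auto simp: nn_integral_add int neg)
  also have "\<dots> = ennreal (1/2) * ennreal 2" by simp
  also have "\<dots> = 1" by (subst ennreal_mult'[symmetric]) simp_all
  finally show "emeasure (laplace b) (space (laplace b)) = 1" .
qed

text \<open>By the triangle inequality a shift changes the density by at most this factor. The
  integral form applies to a single noise coordinate while the others are frozen.\<close>

lemma nn_integral_laplace_shift:
  assumes b: "0 < b" and [measurable]: "g \<in> borel_measurable borel"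
  shows "(\<integral>\<^sup>+x. g (\<Delta> + x) \<partial>laplace b) \<le> ennreal (exp (\<bar>\<Delta>\<bar> / b)) * (\<integral>\<^sup>+x. g x \<partial>laplace b)"
proof -
  let ?l = "\<lambda>x. exp (- \<bar>x\<bar> / b) / (2 * b)"
  have "(\<integral>\<^sup>+x. g (\<Delta> + x) \<partial>laplace b) = (\<integral>\<^sup>+x. ennreal (?l x) * g (\<Delta> + x) \<partial>lborel)"
    unfolding laplace_def by (rule nn_integral_density) auto
  also have "\<dots> = (\<integral>\<^sup>+x. ennreal (?l (x - \<Delta>)) * g x \<partial>lborel)"
    using nn_integral_lborel_translate[of "\<lambda>x. ennreal (?l (x - \<Delta>)) * g x" \<Delta>] by simp
  also have "\<dots> \<le> (\<integral>\<^sup>+x. ennreal (exp (\<bar>\<Delta>\<bar> / b)) * (ennreal (?l x) * g x) \<partial>lborel)"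
  proof (rule nn_integral_mono)
    fix x
    have "\<bar>x\<bar> \<le> \<bar>\<Delta>\<bar> + \<bar>x - \<Delta>\<bar>" by linarith
    then have "- \<bar>x - \<Delta>\<bar> / b \<le> \<bar>\<Delta>\<bar> / b + - \<bar>x\<bar> / b"
      using b by (simp add: field_simps)
    then have "exp (- \<bar>x - \<Delta>\<bar> / b) \<le> exp (\<bar>\<Delta>\<bar> / b) * exp (- \<bar>x\<bar> / b)"
      by (simp flip: exp_add)
    then have "?l (x - \<Delta>) \<le> exp (\<bar>\<Delta>\<bar> / b) * ?l x" using b by (simp add: divide_right_mono)
    then have "ennreal (?l (x - \<Delta>)) \<le> ennreal (exp (\<bar>\<Delta>\<bar> / b)) * ennreal (?l x)"
      by (subst ennreal_mult'[symmetric]) (auto intro!: ennreal_leI)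
    then show "ennreal (?l (x - \<Delta>)) * g x \<le> ennreal (exp (\<bar>\<Delta>\<bar> / b)) * (ennreal (?l x) * g x)"
      by (simp only: mult.assoc[symmetric]) (rule mult_right_mono, simp_all)
  qed
  also have "\<dots> = ennreal (exp (\<bar>\<Delta>\<bar> / b)) * (\<integral>\<^sup>+x. g x \<partial>laplace b)"
    unfolding laplace_def by (subst nn_integral_cmult) (auto simp: nn_integral_density)
  finally show ?thesis .
qed

section \<open>Noisy maximum\<close>

text \<open>Expressing the \<open>LEAST\<close> by inequalities, strict ones below j, makes the tie
  rule explicit; the shift argument then covers ties directly instead of discarding them as a null
  event.\<close>

lemma argmax_idx_eq_iff:
  assumes n: "0 < length v"
  shows "argmax_idx v z = j \<longleftrightarrow> j < length v \<and> (\<forall>k<length v. v ! k + z k \<le> v ! j + z j)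
     \<and> (\<forall>k<j. v ! k + z k < v ! j + z j)"
proof -
  let ?P = "\<lambda>j. j < length v \<and> (\<forall>k<length v. v ! k + z k \<le> v ! j + z j)"
  define S where "S = (\<lambda>k. v ! k + z k) ` {..<length v}"
  have "finite S" "S \<noteq> {}" using n by (auto simp: S_def)
  then have "Max S \<in> S" and ub: "\<And>y. y \<in> S \<Longrightarrow> y \<le> Max S" by auto
  then obtain m where m: "m < length v" "Max S = v ! m + z m" by (auto simp: S_def)
  have "?P m"
  proof (intro conjI allI impI m(1))
    fix k assume "k < length v"
    then have "v ! k + z k \<in> S" by (simp add: S_def)
    from ub[OF this] show "v ! k + z k \<le> v ! m + z m" by (simp add: m(2))
  qed
  then have P: "?P (argmax_idx v z)" unfolding argmax_idx_def by (rule LeastI)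
  have lt: "v ! k + z k < v ! argmax_idx v z + z (argmax_idx v z)" if "k < argmax_idx v z" for k
  proof (rule ccontr)
    assume "\<not> ?thesis"
    then have "?P k" using P that by force
    then have "argmax_idx v z \<le> k" unfolding argmax_idx_def by (rule Least_le)
    then show False using that by simp
  qed
  show ?thesis
  proof
    assume R: "j < length v \<and> (\<forall>k<length v. v ! k + z k \<le> v ! j + z j) \<and> (\<forall>k<j. v ! k + z k < v ! j + z j)"
    show "argmax_idx v z = j"
    proof (rule linorder_cases[of "argmax_idx v z" j])
      assume "argmax_idx v z < j"
      with R have "v ! argmax_idx v z + z (argmax_idx v z) < v ! j + z j" by blast
      moreover have "v ! j + z j \<le> v ! argmax_idx v z + z (argmax_idx v z)" using P R by blast
      ultimately show ?thesis by simp
    next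
      assume "j < argmax_idx v z"
      with lt have "v ! j + z j < v ! argmax_idx v z + z (argmax_idx v z)" by blast
      moreover have "v ! argmax_idx v z + z (argmax_idx v z) \<le> v ! j + z j" using P R by blast
      ultimately show ?thesis by simp
    qed
  qed (use P lt in blast)
qed

lemma argmax_idx_less: "0 < length v \<Longrightarrow> argmax_idx v z < length v"
  using argmax_idx_eq_iff[of v z "argmax_idx v z"] by simp

text \<open>Measurability must hold jointly in parameter and noise, because the scores depend on an
  iterate and a direction that are themselves random. It holds because the index is the least number
  satisfying a sequence of measurable predicates.\<close>

lemma argmax_idx_measurable_kernel:
  fixes v :: "'x \<Rightarrow> real list"
  assumes len: "\<And>x. length (v x) = n" and v: "\<And>k. k < n \<Longrightarrow> (\<lambda>x. v x ! k) \<in> borel_measurable M"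
    and N: "\<And>k. k < n \<Longrightarrow> sets (N k) = sets borel"
  shows "(\<lambda>(x, z). argmax_idx (v x) z) \<in> M \<Otimes>\<^sub>M PiM {..<n} N \<rightarrow>\<^sub>M count_space UNIV"
proof -
  have 1: "(\<lambda>p. v (fst p) ! k + snd p k) \<in> borel_measurable (M \<Otimes>\<^sub>M PiM {..<n} N)" if k: "k < n" for k
  proof (rule borel_measurable_add)
    show "(\<lambda>p. v (fst p) ! k) \<in> borel_measurable (M \<Otimes>\<^sub>M PiM {..<n} N)"
      by (rule measurable_compose[OF measurable_fst v[OF k]])
    have "(\<lambda>p. snd p k) \<in> M \<Otimes>\<^sub>M PiM {..<n} N \<rightarrow>\<^sub>M N k"
      by (rule measurable_compose[OF measurable_snd measurable_component_singleton]) (use k in auto)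
    then show "(\<lambda>p. snd p k) \<in> borel_measurable (M \<Otimes>\<^sub>M PiM {..<n} N)"
      using N[OF k] by (simp cong: measurable_cong_sets)
  qed
  have 2: "Measurable.pred (M \<Otimes>\<^sub>M PiM {..<n} N)
     (\<lambda>p. j < n \<and> (\<forall>k\<in>{..<n}. v (fst p) ! k + snd p k \<le> v (fst p) ! j + snd p j))" for j
  proof (cases "j < n")
    case True
    then show ?thesis
      by (intro pred_intros_logic pred_intros_finite) (auto intro!: borel_measurable_le 1 simp: pred_def)
  qed simp
  have "(\<lambda>p. LEAST j. j < n \<and> (\<forall>k\<in>{..<n}. v (fst p) ! k + snd p k \<le> v (fst p) ! j + snd p j))
      \<in> M \<Otimes>\<^sub>M PiM {..<n} N \<rightarrow>\<^sub>M count_space UNIV"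
    by (rule measurable_Least) (rule 2)
  moreover have "(\<lambda>(x, z). argmax_idx (v x) z)
      = (\<lambda>p. LEAST j. j < n \<and> (\<forall>k\<in>{..<n}. v (fst p) ! k + snd p k \<le> v (fst p) ! j + snd p j))"
    by (rule ext) (simp add: argmax_idx_def len case_prod_beta Ball_def)
  ultimately show ?thesis by (simp only:)
qed

lemma argmax_idx_measurable[measurable]:
  "argmax_idx v \<in> PiM {..<length v} (\<lambda>_. laplace b) \<rightarrow>\<^sub>M count_space UNIV"
proof -
  \<comment> \<open>A one-point parameter space turns a fixed score list into an instance of the
    kernel lemma.\<close>
  have *: "(\<lambda>(x, z). argmax_idx v z) \<in> count_space (UNIV :: unit set) \<Otimes>\<^sub>M PiM {..<length v} (\<lambda>_. laplace b) \<rightarrow>\<^sub>M count_space UNIV"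
    by (rule argmax_idx_measurable_kernel[where v="\<lambda>_. v"]) auto
  show ?thesis
    using measurable_compose[OF measurable_Pair1'[of "()" "count_space UNIV"] *] by simp
qed

lemma prob_space_PiM_laplace: "0 < b \<Longrightarrow> prob_space (PiM I (\<lambda>_. laplace b))"
  by (intro prob_space_PiM prob_space_laplace)

text \<open>Since the length n is the same for all x, the noise is one fixed product measure and
  only the selection map depends on x.\<close>

lemma noisy_max_kernel:
  fixes v :: "'x \<Rightarrow> real list"
  assumes len: "\<And>x. length (v x) = n" and v: "\<And>k. k < n \<Longrightarrow> (\<lambda>x. v x ! k) \<in> borel_measurable M"
    and b: "0 < \<Delta> / \<epsilon>"
  shows "(\<lambda>x. noisy_max (v x) \<Delta> \<epsilon>) \<in> M \<rightarrow>\<^sub>M prob_algebra (count_space UNIV)"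
  unfolding noisy_max_def len
proof (rule measurable_distr_prob_space2)
  show "(\<lambda>x. PiM {..<n} (\<lambda>_. laplace (\<Delta> / \<epsilon>))) \<in> M \<rightarrow>\<^sub>M prob_algebra (PiM {..<n} (\<lambda>_. laplace (\<Delta> / \<epsilon>)))"
    by (rule measurable_const) (simp add: space_prob_algebra prob_space_PiM_laplace[OF b])
  show "(\<lambda>(x, y). argmax_idx (v x) y) \<in> M \<Otimes>\<^sub>M PiM {..<n} (\<lambda>_. laplace (\<Delta> / \<epsilon>)) \<rightarrow>\<^sub>M count_space UNIV"
    by (rule argmax_idx_measurable_kernel[OF len v]) auto
qed

lemma sets_noisy_max[simp]: "sets (noisy_max v \<Delta> \<epsilon>) = UNIV"
  by (simp add: noisy_max_def)

lemma prob_space_noisy_max: "0 < \<Delta> / \<epsilon> \<Longrightarrow> prob_space (noisy_max v \<Delta> \<epsilon>)"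
  unfolding noisy_max_def by (intro prob_space.prob_space_distr prob_space_PiM_laplace argmax_idx_measurable)

text \<open>If j wins for the scores v, then it wins for v' once its own noise is raised by \<Delta>; this shift
  of one Laplace coordinate costs a factor exp \<epsilon>. The hypothesis only bounds the spread of
  v' - v, which is why monotone scores of sensitivity \<Delta> need no factor 2.\<close>
lemma noisy_max_pure_DP:
  assumes b: "0 < \<epsilon>" "0 < \<Delta>" and n: "0 < length v" "length v' = length v"
    and d: "\<And>j k. j < length v \<Longrightarrow> k < length v \<Longrightarrow> v' ! k - v ! k \<le> v' ! j - v ! j + \<Delta>"
  shows "measure (noisy_max v \<Delta> \<epsilon>) {j} \<le> exp \<epsilon> * measure (noisy_max v' \<Delta> \<epsilon>) {j}"
proof (cases "j < length v")
  case False
  have "argmax_idx v -` {j} = {}" using False argmax_idx_less[OF n(1)] by auto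
  then show ?thesis by (simp add: noisy_max_def measure_distr)
next
  case j: True
  define \<beta> where "\<beta> = \<Delta> / \<epsilon>"
  have \<beta>: "0 < \<beta>" using b by (simp add: \<beta>_def)
  define L where "L = laplace \<beta>"
  interpret L: prob_space L unfolding L_def by (rule prob_space_laplace[OF \<beta>])
  interpret product_sigma_finite "\<lambda>_::nat. L" by standard
  define I where "I = {..<length v}"
  define I' where "I' = I - {j}"
  have I: "I = insert j I'" "finite I'" "j \<notin> I'" using j by (auto simp: I_def I'_def)
  define E where "E = (\<lambda>w. {z. argmax_idx w z = j} \<inter> space (PiM I (\<lambda>_. L)))"
  have meas: "argmax_idx w \<in> PiM I (\<lambda>_. L) \<rightarrow>\<^sub>M count_space UNIV" if "length w = length v" for w
    using argmax_idx_measurable[of w \<beta>] that by (simp add: L_def I_def)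
  have E: "E w \<in> sets (PiM I (\<lambda>_. L))" if "length w = length v" for w
    using measurable_sets[OF meas[OF that], of "{j}"] by (simp add: E_def vimage_def)
  have em: "emeasure (noisy_max w \<Delta> \<epsilon>) {j} = (\<integral>\<^sup>+z. indicator (E w) z \<partial>PiM I (\<lambda>_. L))" if "length w = length v" for w
    using that E[OF that] meas[OF that]
    by (simp add: noisy_max_def emeasure_distr E_def I_def L_def \<beta>_def vimage_def)
  have spL: "space L = UNIV" by (simp add: L_def)
  have upd: "x(j := y) \<in> space (PiM I (\<lambda>_. L))" if "x \<in> space (PiM I' (\<lambda>_. L))" for x y
    using that unfolding I(1) by (auto simp: space_PiM spL PiE_iff extensional_def)
  \<comment> \<open>From v to v' the score of a competitor k gains at most \<Delta> more than that
    of j, which the raised noise of j makes up for; strict inequalities below j survive in the same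
    way.\<close>
  have shift: "x(j := y) \<in> E v \<Longrightarrow> x(j := \<Delta> + y) \<in> E v'" if x: "x \<in> space (PiM I' (\<lambda>_. L))" for x y
  proof -
    assume "x(j := y) \<in> E v"
    then have a: "argmax_idx v (x(j := y)) = j" by (simp add: E_def)
    have "argmax_idx v' (x(j := \<Delta> + y)) = j"
      unfolding argmax_idx_eq_iff[OF n(1)[folded n(2)]] n(2)
    proof (intro conjI allI impI j)
      fix k assume k: "k < length v"
      show "v' ! k + (x(j := \<Delta> + y)) k \<le> v' ! j + (x(j := \<Delta> + y)) j"
        using a[unfolded argmax_idx_eq_iff[OF n(1)]] k d[OF j k] b by (auto simp: fun_upd_def split: if_splits)
    next
      fix k assume k: "k < j"
      then show "v' ! k + (x(j := \<Delta> + y)) k < v' ! j + (x(j := \<Delta> + y)) j"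
        using a[unfolded argmax_idx_eq_iff[OF n(1)]] j d[OF j, of k] b by (force simp: fun_upd_def split: if_splits)
    qed
    then show ?thesis using upd[OF x] by (simp add: E_def)
  qed
  note E1 = E[OF refl] note E2 = E[OF n(2)]
  have upd_meas: "(\<lambda>y. indicator (E v') (x(j := y)) :: ennreal) \<in> borel_measurable L" if "x \<in> space (PiM I' (\<lambda>_. L))" for x
  proof (rule measurable_compose[OF measurable_component_update[OF that I(3)]])
    show "indicator (E v') \<in> borel_measurable (PiM (insert j I') (\<lambda>_. L))"
      using E2 unfolding I(1) by (rule borel_measurable_indicator)
  qed
  \<comment> \<open>Fubini with coordinate j innermost: all other noises are frozen, and the shift
    by \<Delta> acts on one Laplace variable of scale \<Delta> / \<epsilon>, hence the factor exp
    \<epsilon>.\<close>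
  have "emeasure (noisy_max v \<Delta> \<epsilon>) {j} = (\<integral>\<^sup>+x. (\<integral>\<^sup>+y. indicator (E v) (x(j := y)) \<partial>L) \<partial>PiM I' (\<lambda>_. L))"
    using E1 unfolding em[OF refl] I(1) by (intro product_nn_integral_insert I) auto
  also have "\<dots> \<le> (\<integral>\<^sup>+x. (\<integral>\<^sup>+y. indicator (E v') (x(j := \<Delta> + y)) \<partial>L) \<partial>PiM I' (\<lambda>_. L))"
    by (intro nn_integral_mono) (auto simp: indicator_def shift)
  also have "\<dots> \<le> (\<integral>\<^sup>+x. ennreal (exp \<epsilon>) * (\<integral>\<^sup>+y. indicator (E v') (x(j := y)) \<partial>L) \<partial>PiM I' (\<lambda>_. L))"
  proof (rule nn_integral_mono)
    fix x assume x: "x \<in> space (PiM I' (\<lambda>_. L))"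
    have "\<bar>\<Delta>\<bar> / \<beta> = \<epsilon>" using b by (simp add: \<beta>_def)
    moreover have "(\<lambda>y. indicator (E v') (x(j := y)) :: ennreal) \<in> borel_measurable borel"
      using upd_meas[OF x] by (simp add: L_def cong: measurable_cong_sets)
    ultimately show "(\<integral>\<^sup>+y. indicator (E v') (x(j := \<Delta> + y)) \<partial>L) \<le> ennreal (exp \<epsilon>) * (\<integral>\<^sup>+y. indicator (E v') (x(j := y)) \<partial>L)"
      using nn_integral_laplace_shift[OF \<beta>, of "\<lambda>y. indicator (E v') (x(j := y))" \<Delta>] by (simp add: L_def)
  qed
  also have "\<dots> = ennreal (exp \<epsilon>) * (\<integral>\<^sup>+x. (\<integral>\<^sup>+y. indicator (E v') (x(j := y)) \<partial>L) \<partial>PiM I' (\<lambda>_. L))"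
  proof (rule nn_integral_cmult)
    have [measurable]: "E v' \<in> sets (PiM (insert j I') (\<lambda>_. L))" using E2 I(1) by simp
    show "(\<lambda>x. \<integral>\<^sup>+y. indicator (E v') (x(j := y)) \<partial>L) \<in> borel_measurable (PiM I' (\<lambda>_. L))"
      by measurable
  qed
  also have "(\<integral>\<^sup>+x. (\<integral>\<^sup>+y. indicator (E v') (x(j := y)) \<partial>L) \<partial>PiM I' (\<lambda>_. L)) = emeasure (noisy_max v' \<Delta> \<epsilon>) {j}"
    using E2 unfolding em[OF n(2)] I(1) by (intro product_nn_integral_insert[symmetric] I) auto
  finally have *: "emeasure (noisy_max v \<Delta> \<epsilon>) {j} \<le> ennreal (exp \<epsilon>) * emeasure (noisy_max v' \<Delta> \<epsilon>) {j}" .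
  interpret M1: prob_space "noisy_max v \<Delta> \<epsilon>" by (rule prob_space_noisy_max) (use b in simp)
  interpret M2: prob_space "noisy_max v' \<Delta> \<epsilon>" by (rule prob_space_noisy_max) (use b in simp)
  show ?thesis using *
    by (simp add: M1.emeasure_eq_measure M2.emeasure_eq_measure flip: ennreal_mult')
qed

text \<open>The spread condition is symmetric in v and v', so the pure bound holds in both
  directions. The finite support is the set of list positions.\<close>

lemma noisy_max_renyi_bounded:
  assumes \<alpha>: "1 < \<alpha>" and b: "0 < \<epsilon>" "0 < \<Delta>" and n: "0 < length v" "length v' = length v"
    and d: "\<And>j k. j < length v \<Longrightarrow> k < length v \<Longrightarrow> \<bar>(v' ! k - v ! k) - (v' ! j - v ! j)\<bar> \<le> \<Delta>"
  shows "renyi_bounded \<alpha> (exp ((\<alpha> - 1) * (\<epsilon>\<^sup>2 / 2))) (noisy_max v \<Delta> \<epsilon>) (noisy_max v' \<Delta> \<epsilon>)"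
proof -
  have AE: "AE i in noisy_max w \<Delta> \<epsilon>. i \<in> {..<length v}" if "length w = length v" for w
  proof -
    have "argmax_idx w z < length v" for z using argmax_idx_less[of w] n that by simp
    then show ?thesis
      unfolding noisy_max_def by (subst AE_distr_iff[OF argmax_idx_measurable]) auto
  qed
  show ?thesis
  proof (rule pure_DP_renyi_bounded[OF \<alpha>, where A="{..<length v}"])
    show "prob_space (noisy_max v \<Delta> \<epsilon>)" "prob_space (noisy_max v' \<Delta> \<epsilon>)"
      using b by (auto intro!: prob_space_noisy_max)
    show "measure (noisy_max v \<Delta> \<epsilon>) {j} \<le> exp \<epsilon> * measure (noisy_max v' \<Delta> \<epsilon>) {j}" for j
    proof (rule noisy_max_pure_DP[OF b n])
      fix j k assume "j < length v" "k < length v"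
      then show "v' ! k - v ! k \<le> v' ! j - v ! j + \<Delta>" using d[of j k] by (simp add: abs_le_iff)
    qed
    show "measure (noisy_max v' \<Delta> \<epsilon>) {j} \<le> exp \<epsilon> * measure (noisy_max v \<Delta> \<epsilon>) {j}" for j
    proof (rule noisy_max_pure_DP[OF b])
      fix j k assume "j < length v'" "k < length v'"
      then show "v ! k - v' ! k \<le> v ! j - v' ! j + \<Delta>" using d[of j k] n by (simp add: abs_le_iff)
    qed (use n in auto)
  qed (use AE[OF refl] AE[OF n(2)] in auto)
qed

section \<open>Gradients and clipping\<close>

text \<open>\<open>grad\<close> is a choice by \<open>SOME\<close>, so some gradient has to be
  exhibited: the vector whose coordinates are the values of the derivative on the basis.\<close>

lemma GDERIV_grad:
  fixes f :: "'a::euclidean_space \<Rightarrow> real"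
  assumes "f differentiable (at w)"
  shows "GDERIV f w :> grad f w"
proof -
  from assms obtain f' where f': "(f has_derivative f') (at w)" by (auto simp: differentiable_def)
  interpret f': linear f' by (rule has_derivative_linear[OF f'])
  have "f' h = h \<bullet> (\<Sum>b\<in>Basis. f' b *\<^sub>R b)" for h
  proof -
    have "f' h = f' (\<Sum>b\<in>Basis. (h \<bullet> b) *\<^sub>R b)" by (simp add: euclidean_representation)
    also have "\<dots> = (\<Sum>b\<in>Basis. (h \<bullet> b) * f' b)" by (simp add: f'.sum f'.scaleR)
    also have "\<dots> = h \<bullet> (\<Sum>b\<in>Basis. f' b *\<^sub>R b)" by (simp add: inner_sum_right mult.commute)
    finally show ?thesis .
  qed
  then have "f' = (\<lambda>h. h \<bullet> (\<Sum>b\<in>Basis. f' b *\<^sub>R b))" by (rule ext)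
  with f' have "GDERIV f w :> (\<Sum>b\<in>Basis. f' b *\<^sub>R b)" unfolding gderiv_def by (simp only:)
  then show ?thesis unfolding grad_def by (rule someI)
qed

text \<open>The gradient may be discontinuous. Its coordinates are still pointwise limits of
  difference quotients of a continuous function, taken along the steps 1 / (n + 1).\<close>

lemma grad_measurable:
  fixes f :: "'a::euclidean_space \<Rightarrow> real"
  assumes d: "\<And>w. f differentiable (at w)"
  shows "grad f \<in> borel_measurable borel"
proof -
  have cont: "continuous_on UNIV f"
    by (rule continuous_at_imp_continuous_on) (use d differentiable_imp_continuous_within in blast)
  have [measurable]: "f \<in> borel_measurable borel"
    by (rule borel_measurable_continuous_onI[OF cont])
  have comp: "(\<lambda>w. grad f w \<bullet> b) \<in> borel_measurable borel" for b :: 'a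
  proof (rule borel_measurable_LIMSEQ_real)
    fix w
    have "(f has_derivative (\<lambda>h. h \<bullet> grad f w)) (at (w + 0 *\<^sub>R b))"
      using GDERIV_grad[OF d] by (simp add: gderiv_def)
    moreover have "((\<lambda>t. w + t *\<^sub>R b) has_derivative (\<lambda>t. t *\<^sub>R b)) (at 0)"
      by (auto intro!: derivative_eq_intros)
    ultimately have "((\<lambda>t. f (w + t *\<^sub>R b)) has_derivative (\<lambda>t. (t *\<^sub>R b) \<bullet> grad f w)) (at 0)"
      by (rule has_derivative_compose[rotated])
    then have "((\<lambda>t. f (w + t *\<^sub>R b)) has_real_derivative (grad f w \<bullet> b)) (at 0)"
      by (rule has_derivative_imp_has_field_derivative) (simp add: inner_commute)
    then have "((\<lambda>t. (f (w + t *\<^sub>R b) - f w) / t) \<longlongrightarrow> grad f w \<bullet> b) (at 0)"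
      by (simp add: DERIV_def)
    moreover have "filterlim (\<lambda>n. inverse (real (Suc n))) (at 0) sequentially"
      using LIMSEQ_inverse_real_of_nat by (simp add: filterlim_at)
    ultimately show "(\<lambda>n. (f (w + inverse (real (Suc n)) *\<^sub>R b) - f w) / inverse (real (Suc n))) \<longlonglongrightarrow> grad f w \<bullet> b"
      by (rule filterlim_compose)
  qed measurable
  show ?thesis
    by (subst borel_measurable_euclidean_space) (auto intro: comp)
qed

lemma clipped_grad_measurable:
  assumes d: "\<And>d w. (\<lambda>v. loss v d) differentiable (at w)"
  shows "clipped_grad loss D C \<in> borel_measurable borel"
proof -
  have [measurable]: "grad (\<lambda>v. loss v d) \<in> borel_measurable borel" for d
    by (rule grad_measurable[OF d])
  have "(\<lambda>w. clipped_grad loss D C w) \<in> borel_measurable borel"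
    by (induction D) (simp_all add: clipped_grad_def)
  then show ?thesis by simp
qed

lemma clipped_obj_measurable:
  assumes d: "\<And>d w. (\<lambda>v. loss v d) differentiable (at w)"
  shows "clipped_obj loss C D \<in> borel_measurable borel"
proof -
  have [measurable]: "(\<lambda>v. loss v d) \<in> borel_measurable borel" for d
    by (intro borel_measurable_continuous_onI continuous_at_imp_continuous_on ballI)
       (use d differentiable_imp_continuous_within in blast)
  have "(\<lambda>w. clipped_obj loss C D w) \<in> borel_measurable borel"
    by (induction D) (simp_all add: clipped_obj_def)
  then show ?thesis by simp
qed

lemma norm_clip_le:
  assumes "0 < C"
  shows "norm (v /\<^sub>R max 1 (norm v / C)) \<le> C"
  using assms by (cases "norm v \<le> C") (auto simp: max_def field_simps)

text \<open>Under the add-or-remove relation the difference is a single clipped gradient, so C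
  suffices instead of 2 * C.\<close>

lemma clipped_grad_sensitivity:
  assumes "0 < C" "neighbors D D'"
  shows "norm (clipped_grad loss D C w - clipped_grad loss D' C w) \<le> C"
proof -
  have *: "norm (clipped_grad loss (D + {#d#}) C w - clipped_grad loss D C w) \<le> C" for D d
  proof -
    let ?g = "grad (\<lambda>v. loss v d) w"
    have "clipped_grad loss (D + {#d#}) C w - clipped_grad loss D C w = ?g /\<^sub>R max 1 (norm ?g / C)"
      by (simp add: clipped_grad_def)
    then show ?thesis using norm_clip_le[OF assms(1), of ?g] by (simp only:)
  qed
  from assms(2) consider d where "D' = D + {#d#}" | d where "D = D' + {#d#}"
    unfolding neighbors_def by blast
  then show ?thesis
  proof cases
    case (1 d)
    then show ?thesis using *[of D d] by (simp only: norm_minus_commute)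
  next
    case (2 d)
    then show ?thesis using *[of D' d] by (simp only:)
  qed
qed

text \<open>The increments at x and y both lie in [0, C] when a record is added and both in [-C, 0]
  when one is removed, so they are at most C apart.\<close>

lemma clipped_obj_sensitivity:
  assumes C: "0 < C" and l: "\<And>w d. 0 \<le> loss w d" and n: "neighbors D D'"
  shows "\<bar>(clipped_obj loss C D' x - clipped_obj loss C D x)
        - (clipped_obj loss C D' y - clipped_obj loss C D y)\<bar> \<le> C"
proof -
  define m where "m z d = min (loss z d) C" for z d
  have m: "0 \<le> m z d" "m z d \<le> C" for z d using l[of z d] C by (auto simp: m_def)
  have eq: "clipped_obj loss C (E + {#d#}) z = clipped_obj loss C E z + m z d" for E d z
    by (simp add: clipped_obj_def m_def)
  from n consider d where "D' = D + {#d#}" | d where "D = D' + {#d#}"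
    unfolding neighbors_def by blast
  then show ?thesis
  proof cases
    case (1 d)
    show ?thesis unfolding 1 eq using m[of x d] m[of y d] by linarith
  next
    case (2 d)
    show ?thesis unfolding 2 eq using m[of x d] m[of y d] by linarith
  qed
qed

section \<open>The DP-AGD loop\<close>

text \<open>The variance is calibrated so that sensitivity C costs exactly c. Absorbing the centre
  into the noise law puts the data dependence of the release into that law, so composition applies
  with continuations K and L that may use the database again.\<close>

lemma gauss_step_renyi_bounded:
  fixes a b :: "'a::euclidean_space"
  assumes \<alpha>: "1 < \<alpha>" and c: "0 < c" and C: "0 < C" and ab: "norm (a - b) \<le> C"
    and K: "K \<in> borel \<rightarrow>\<^sub>M prob_algebra N" and L: "L \<in> borel \<rightarrow>\<^sub>M prob_algebra N"
    and KL: "\<And>y. renyi_bounded \<alpha> (exp ((\<alpha> - 1) * \<sigma>)) (K y) (L y)"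
  shows "renyi_bounded \<alpha> (exp ((\<alpha> - 1) * (c + \<sigma>)))
     (gauss_vec (C\<^sup>2 / (2 * c)) \<bind> (\<lambda>z. K (a + z))) (gauss_vec (C\<^sup>2 / (2 * c)) \<bind> (\<lambda>z. L (b + z)))"
proof -
  define s where "s = C\<^sup>2 / (2 * c)"
  have s: "0 < s" using c C by (simp add: s_def)
  interpret G: prob_space "gauss_vec s :: 'a measure" by (rule prob_space_gauss_vec[OF s])
  have bind: "gauss_vec s \<bind> (\<lambda>z. K (a + z)) = distr (gauss_vec s) borel (\<lambda>z. a + z) \<bind> K"
    if "K \<in> borel \<rightarrow>\<^sub>M prob_algebra N" for K and a :: 'a
    by (rule bind_distr[symmetric, OF _ measurable_prob_algebraD[OF that]]) auto
  have sp: "distr (gauss_vec s) borel (\<lambda>z. a + z) \<in> space (prob_algebra borel)" for a :: 'a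
    by (auto simp: space_prob_algebra intro!: G.prob_space_distr)
  have "(norm (a - b))\<^sup>2 \<le> C\<^sup>2" using ab by (intro power_mono) auto
  then have "(norm (a - b))\<^sup>2 \<le> 2 * s * c" using c by (simp add: s_def)
  then have "renyi_bounded \<alpha> (exp ((\<alpha> - 1) * c))
     (distr (gauss_vec s) borel (\<lambda>z. a + z)) (distr (gauss_vec s) borel (\<lambda>z. b + z))"
    by (rule gauss_vec_renyi_bounded[OF \<alpha> s])
  then have "renyi_bounded \<alpha> (exp ((\<alpha> - 1) * c) * exp ((\<alpha> - 1) * \<sigma>))
     (distr (gauss_vec s) borel (\<lambda>z. a + z) \<bind> K) (distr (gauss_vec s) borel (\<lambda>z. b + z) \<bind> L)"
    by (intro renyi_bounded_bind[OF \<alpha> sp sp K L]) (simp_all add: KL)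
  then show ?thesis unfolding s_def[symmetric] bind[OF K] bind[OF L]
    by (simp only: exp_add distrib_left)
qed

lemma bind_return_const: "prob_space M \<Longrightarrow> x \<in> space N \<Longrightarrow> M \<bind> (\<lambda>_. return N x) = return N x"
  by (rule bind_const') (auto intro: prob_space_imp_subprob_space prob_space_return)

text \<open>The result depends neither on the database nor on the direction held in the phase; this
  is what hides the noise drawn by an overdrawing step.\<close>

lemma dpagd_loop_exhausted: "\<rho> \<le> 0 \<Longrightarrow> dpagd_loop loss r Cobj Cgrad \<rho>nmax \<gamma> \<Phi> D k (w, \<rho>, t) = return borel w"
  by (cases k; cases t) auto

locale dpagd_setting =
  fixes loss :: "'a::euclidean_space \<Rightarrow> 'a \<times> real \<Rightarrow> real"
    and r :: "'a \<Rightarrow> real"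
    and \<Phi> :: "real list \<Rightarrow> real list"
    and Cobj Cgrad \<rho>nmax \<gamma> :: real
  assumes Cobj: "0 < Cobj" and Cgrad: "0 < Cgrad" and \<rho>nmax: "0 < \<rho>nmax" and \<gamma>: "0 < \<gamma>"
    and loss_nonneg: "\<And>w d. 0 \<le> loss w d"
    and loss_diff: "\<And>d w. (\<lambda>v. loss v d) differentiable (at w)"
    and r_diff: "\<And>w. r differentiable (at w)"
    and \<Phi>: "\<And>hist. 0 < length (\<Phi> hist)"
begin

abbreviation "loop \<equiv> dpagd_loop loss r Cobj Cgrad \<rho>nmax \<gamma> \<Phi>"

definition scores :: "('a \<times> real) multiset \<Rightarrow> real list \<Rightarrow> 'a \<Rightarrow> 'a \<Rightarrow> real list" where
  "scores D hist w g = map uminus (map (\<lambda>\<alpha>. clipped_obj loss Cobj D (w - \<alpha> *\<^sub>R g) + r (w - \<alpha> *\<^sub>R g)) (\<Phi> hist))"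

definition grad_center :: "('a \<times> real) multiset \<Rightarrow> 'a \<Rightarrow> 'a" where
  "grad_center D w = clipped_grad loss D Cgrad w + grad r w"

abbreviation "gauss_noise c \<equiv> gauss_vec (Cgrad\<^sup>2 / (2 * c))"

text \<open>\<open>\<gamma> * \<rho>ng\<close> is the increment from \<rho>ng to (1 + \<gamma>) *
  \<rho>ng, so the weights are the budgets spent on the two estimates. For privacy this map is
  post-processing of the fresh noisy gradient.\<close>

definition average_dir :: "real \<Rightarrow> 'a \<Rightarrow> 'a \<Rightarrow> 'a" where
  "average_dir \<rho>ng g g2 = (\<rho>ng *\<^sub>R g + (\<gamma> * \<rho>ng) *\<^sub>R g2) /\<^sub>R ((1 + \<gamma>) * \<rho>ng)"

text \<open>Here and in \<open>select_step\<close>, \<rho> is the budget left after the noisy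
  maximum has been paid for.\<close>

definition refine_step where
  "refine_step D k w \<rho> \<rho>ng hist g = gauss_noise (\<gamma> * \<rho>ng) \<bind> (\<lambda>z.
     loop D k (w, \<rho> - \<gamma> * \<rho>ng, (1 + \<gamma>) * \<rho>ng, hist, Some (average_dir \<rho>ng g (grad_center D w + z))))"

definition select_step where
  "select_step D k w \<rho> \<rho>ng hist g i =
     (if 0 < i then
        (if 0 < \<rho> then loop D k (w - (\<Phi> hist ! i) *\<^sub>R g, \<rho>, \<rho>ng, hist @ [\<Phi> hist ! i], None)
         else return borel w)
      else refine_step D k w \<rho> \<rho>ng hist g)"

lemma loop_None:
  "0 < \<rho> \<Longrightarrow> loop D (Suc k) (w, \<rho>, \<rho>ng, hist, None) = gauss_noise \<rho>ng \<bind> (\<lambda>z.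
     loop D k (w, \<rho> - \<rho>ng, \<rho>ng, hist, Some ((grad_center D w + z) /\<^sub>R norm (grad_center D w + z))))"
  by (simp add: grad_center_def Let_def)

lemma loop_Some:
  assumes "0 < \<rho>"
  shows "loop D (Suc k) (w, \<rho>, \<rho>ng, hist, Some g) =
     noisy_max (scores D hist w g) Cobj (sqrt (2 * \<rho>nmax)) \<bind> select_step D k w (\<rho> - \<rho>nmax) \<rho>ng hist g"
proof -
  have e: "(1 + \<gamma>) * \<rho>ng - \<rho>ng = \<gamma> * \<rho>ng" by (simp add: algebra_simps)
  show ?thesis using assms
    by (simp only: dpagd_loop.simps case_prod_conv option.case Let_def e not_le[symmetric] if_False
        scores_def select_step_def[abs_def] refine_step_def grad_center_def average_dir_def)
qed

section \<open>Measurability of the loop in the iterate and the direction\<close>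

lemma measurable_data [measurable]:
  "clipped_obj loss Cobj D \<in> borel_measurable borel" "grad_center D \<in> borel_measurable borel"
  "r \<in> borel_measurable borel"
proof -
  show "clipped_obj loss Cobj D \<in> borel_measurable borel" by (rule clipped_obj_measurable[OF loss_diff])
  have [measurable]: "clipped_grad loss D Cgrad \<in> borel_measurable borel"
    by (rule clipped_grad_measurable[OF loss_diff])
  have [measurable]: "grad r \<in> borel_measurable borel" by (rule grad_measurable[OF r_diff])
  show "grad_center D \<in> borel_measurable borel" unfolding grad_center_def[abs_def] by measurable
  show "r \<in> borel_measurable borel"
    by (intro borel_measurable_continuous_onI continuous_at_imp_continuous_on ballI)
       (use r_diff differentiable_imp_continuous_within in blast)
qed

lemma noise_pos: "0 < c \<Longrightarrow> 0 < Cgrad\<^sup>2 / (2 * c)"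
  using Cgrad by simp

lemma gauss_noise_const: "0 < c \<Longrightarrow> (\<lambda>_. gauss_noise c :: 'a measure) \<in> M \<rightarrow>\<^sub>M prob_algebra borel"
  by (rule measurable_const) (simp add: space_prob_algebra prob_space_gauss_vec[OF noise_pos])

lemma length_scores: "length (scores D hist w g) = length (\<Phi> hist)"
  by (simp add: scores_def)

lemma scores_nth:
  "j < length (\<Phi> hist) \<Longrightarrow> scores D hist w g ! j =
     - (clipped_obj loss Cobj D (w - (\<Phi> hist ! j) *\<^sub>R g) + r (w - (\<Phi> hist ! j) *\<^sub>R g))"
  by (simp add: scores_def)

lemma nmax_pos: "0 < sqrt (2 * \<rho>nmax)" "0 < Cobj / sqrt (2 * \<rho>nmax)"
  using \<rho>nmax Cobj by simp_all

text \<open>Measurability of the continuation is a hypothesis, so that the lemma can serve inside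
  the induction of \<open>loop_kernel\<close>, fed with the induction hypothesis, as well as after
  it.\<close>

lemma refine_step_kernel:
  assumes \<rho>ng: "0 < \<rho>ng"
    and IH: "(\<lambda>(w, g). loop D k (w, \<rho> - \<gamma> * \<rho>ng, (1 + \<gamma>) * \<rho>ng, hist, Some g)) \<in> borel \<Otimes>\<^sub>M borel \<rightarrow>\<^sub>M prob_algebra borel"
  shows "(\<lambda>(w, g). refine_step D k w \<rho> \<rho>ng hist g) \<in> borel \<Otimes>\<^sub>M borel \<rightarrow>\<^sub>M prob_algebra borel"
proof -
  have G: "(\<lambda>_. gauss_noise (\<gamma> * \<rho>ng) :: 'a measure) \<in> borel \<Otimes>\<^sub>M borel \<rightarrow>\<^sub>M prob_algebra borel"
    using \<gamma> \<rho>ng by (intro gauss_noise_const) simp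
  have "(\<lambda>p. (fst (fst p), average_dir \<rho>ng (snd (fst p)) (grad_center D (fst (fst p)) + snd p)))
      \<in> (borel \<Otimes>\<^sub>M borel) \<Otimes>\<^sub>M borel \<rightarrow>\<^sub>M borel \<Otimes>\<^sub>M borel"
    unfolding average_dir_def by measurable
  from measurable_compose[OF this IH]
  have "(\<lambda>(p, z). loop D k (fst p, \<rho> - \<gamma> * \<rho>ng, (1 + \<gamma>) * \<rho>ng, hist,
          Some (average_dir \<rho>ng (snd p) (grad_center D (fst p) + z))))
      \<in> (borel \<Otimes>\<^sub>M borel) \<Otimes>\<^sub>M borel \<rightarrow>\<^sub>M prob_algebra borel"
    by (simp add: case_prod_beta)
  from measurable_bind_prob_space2[OF G this] show ?thesis
    by (simp add: refine_step_def case_prod_beta)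
qed

text \<open>The history only takes countably many values, so measurability is needed in the iterate and the
  direction alone, for a fixed history; \<Phi> may be arbitrary.\<close>
lemma loop_kernel:
  assumes "0 < \<rho>ng"
  shows "(\<lambda>w. loop D k (w, \<rho>, \<rho>ng, hist, None)) \<in> borel \<rightarrow>\<^sub>M prob_algebra borel"
    and "(\<lambda>(w, g). loop D k (w, \<rho>, \<rho>ng, hist, Some g)) \<in> borel \<Otimes>\<^sub>M borel \<rightarrow>\<^sub>M prob_algebra borel"
proof -
  have ret1: "return borel \<in> (borel :: 'a measure) \<rightarrow>\<^sub>M prob_algebra borel"
    by (rule measurable_return_prob_space)
  have ret2: "(\<lambda>(w, g :: 'a). return borel (w :: 'a)) \<in> borel \<Otimes>\<^sub>M borel \<rightarrow>\<^sub>M prob_algebra borel"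
    using measurable_compose[OF measurable_fst ret1] by (simp add: case_prod_beta)
  \<comment> \<open>The phases lead into each other, so both claims go through one
    induction.\<close>
  have "(\<lambda>w. loop D k (w, \<rho>, \<rho>ng, hist, None)) \<in> borel \<rightarrow>\<^sub>M prob_algebra borel \<and>
        (\<lambda>(w, g). loop D k (w, \<rho>, \<rho>ng, hist, Some g)) \<in> borel \<Otimes>\<^sub>M borel \<rightarrow>\<^sub>M prob_algebra borel"
    using assms
  proof (induction k arbitrary: \<rho> \<rho>ng hist)
    case 0
    then show ?case using ret1 ret2 by simp
  next
    case (Suc k)
    note \<rho>ng = \<open>0 < \<rho>ng\<close>
    show ?case
    proof (cases "0 < \<rho>")
      case False
      then show ?thesis using ret1 ret2 by (simp add: dpagd_loop_exhausted)
    next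
      case \<rho>: True
      have IH1: "(\<lambda>w. loop D k (w, \<rho>', \<rho>ng', hist', None)) \<in> borel \<rightarrow>\<^sub>M prob_algebra borel"
        and IH2: "(\<lambda>(w, g). loop D k (w, \<rho>', \<rho>ng', hist', Some g)) \<in> borel \<Otimes>\<^sub>M borel \<rightarrow>\<^sub>M prob_algebra borel"
        if "0 < \<rho>ng'" for \<rho>' \<rho>ng' hist' using Suc.IH[OF that] by blast+
      have "(\<lambda>p. (fst p, (grad_center D (fst p) + snd p) /\<^sub>R norm (grad_center D (fst p) + snd p)))
          \<in> borel \<Otimes>\<^sub>M borel \<rightarrow>\<^sub>M borel \<Otimes>\<^sub>M borel"
        by measurable
      from measurable_compose[OF this IH2[OF \<rho>ng]]
      have "(\<lambda>(w, z). loop D k (w, \<rho> - \<rho>ng, \<rho>ng, hist, Some ((grad_center D w + z) /\<^sub>R norm (grad_center D w + z))))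
          \<in> borel \<Otimes>\<^sub>M borel \<rightarrow>\<^sub>M prob_algebra borel"
        by (simp add: case_prod_beta)
      from measurable_bind_prob_space2[OF gauss_noise_const[OF \<rho>ng] this]
      have 1: "(\<lambda>w. loop D (Suc k) (w, \<rho>, \<rho>ng, hist, None)) \<in> borel \<rightarrow>\<^sub>M prob_algebra borel"
        by (simp only: loop_None[OF \<rho>])
      have "(1 + \<gamma>) * \<rho>ng > 0" using \<gamma> \<rho>ng by simp
      note ref = refine_step_kernel[OF \<rho>ng IH2[OF this]]
      have sel: "(\<lambda>(w, g). select_step D k w (\<rho> - \<rho>nmax) \<rho>ng hist g i) \<in> borel \<Otimes>\<^sub>M borel \<rightarrow>\<^sub>M prob_algebra borel" for i
      proof (cases "0 < i")
        case False
        then show ?thesis using ref by (simp add: select_step_def)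
      next
        case True
        have "(\<lambda>p. fst p - (\<Phi> hist ! i) *\<^sub>R snd p) \<in> borel \<Otimes>\<^sub>M borel \<rightarrow>\<^sub>M (borel :: 'a measure)"
          by measurable
        from measurable_compose[OF this IH1[OF \<rho>ng]] ret2 True show ?thesis
          by (simp add: select_step_def case_prod_beta)
      qed
      have nm: "(\<lambda>p. noisy_max (scores D hist (fst p) (snd p)) Cobj (sqrt (2 * \<rho>nmax)))
          \<in> borel \<Otimes>\<^sub>M borel \<rightarrow>\<^sub>M prob_algebra (count_space UNIV)"
      proof (rule noisy_max_kernel[OF length_scores _ nmax_pos(2)])
        fix j assume j: "j < length (\<Phi> hist)"
        show "(\<lambda>p. scores D hist (fst p) (snd p) ! j) \<in> borel_measurable (borel \<Otimes>\<^sub>M borel)"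
          unfolding scores_nth[OF j] by measurable
      qed
      have "(\<lambda>q. select_step D k (fst (fst q)) (\<rho> - \<rho>nmax) \<rho>ng hist (snd (fst q)) (snd q))
          \<in> (borel \<Otimes>\<^sub>M borel) \<Otimes>\<^sub>M count_space UNIV \<rightarrow>\<^sub>M prob_algebra borel"
      \<comment> \<open>The selected index lives in a countable space, so measurability for each
        fixed index is enough.\<close>
      proof (rule measurable_compose_countable[where f="\<lambda>i q. select_step D k (fst (fst q)) (\<rho> - \<rho>nmax) \<rho>ng hist (snd (fst q)) i"])
        show "(\<lambda>q. select_step D k (fst (fst q)) (\<rho> - \<rho>nmax) \<rho>ng hist (snd (fst q)) i)
          \<in> (borel \<Otimes>\<^sub>M borel) \<Otimes>\<^sub>M count_space UNIV \<rightarrow>\<^sub>M prob_algebra borel" for i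
          using measurable_compose[OF measurable_fst sel[of i]] by (simp add: case_prod_beta)
      qed (rule measurable_snd)
      then have "(\<lambda>(p, i). select_step D k (fst p) (\<rho> - \<rho>nmax) \<rho>ng hist (snd p) i)
          \<in> (borel \<Otimes>\<^sub>M borel) \<Otimes>\<^sub>M count_space UNIV \<rightarrow>\<^sub>M prob_algebra borel"
        by (simp add: case_prod_beta)
      from measurable_bind_prob_space2[OF nm this]
      have 2: "(\<lambda>(w, g). loop D (Suc k) (w, \<rho>, \<rho>ng, hist, Some g)) \<in> borel \<Otimes>\<^sub>M borel \<rightarrow>\<^sub>M prob_algebra borel"
        by (simp only: loop_Some[OF \<rho>] case_prod_unfold)
      from 1 2 show ?thesis by blast
    qed
  qed
  then show "(\<lambda>w. loop D k (w, \<rho>, \<rho>ng, hist, None)) \<in> borel \<rightarrow>\<^sub>M prob_algebra borel"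
    and "(\<lambda>(w, g). loop D k (w, \<rho>, \<rho>ng, hist, Some g)) \<in> borel \<Otimes>\<^sub>M borel \<rightarrow>\<^sub>M prob_algebra borel" by blast+
qed

lemma loop_Some_kernel:
  assumes "0 < \<rho>ng" and "f \<in> borel \<rightarrow>\<^sub>M borel"
  shows "(\<lambda>y. loop D k (w, \<rho>, \<rho>ng, hist, Some (f y))) \<in> borel \<rightarrow>\<^sub>M prob_algebra borel"
  using measurable_compose[OF assms(2) measurable_compose[OF measurable_Pair1' loop_kernel(2)[OF assms(1)]]]
  by simp

section \<open>Privacy accounting along the loop\<close>

lemma renyi_bounded_return_budget:
  "1 < \<alpha> \<Longrightarrow> renyi_bounded \<alpha> (exp ((\<alpha> - 1) * max 0 \<rho>)) (return borel w) (return borel w)"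
  by (rule renyi_bounded_return) auto

text \<open>One lemma for both uses of Gaussian noise: f is normalisation for a fresh gradient and
  \<open>average_dir\<close> for a refinement. The budget splits into c for the release and \<rho> -
  c for the continuation, unless c exhausts it and both sides are the same point mass.\<close>

lemma gauss_step_budget:
  assumes \<alpha>: "1 < \<alpha>" and n: "neighbors D D'" and c: "0 < c" and \<rho>ng: "0 < \<rho>ng" and f: "f \<in> borel \<rightarrow>\<^sub>M borel"
    and \<rho>: "0 < \<rho>"
    and IH: "\<And>g. renyi_bounded \<alpha> (exp ((\<alpha> - 1) * max 0 (\<rho> - c)))
       (loop D k (w, \<rho> - c, \<rho>ng, hist, Some g)) (loop D' k (w, \<rho> - c, \<rho>ng, hist, Some g))"
  shows "renyi_bounded \<alpha> (exp ((\<alpha> - 1) * max 0 \<rho>))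
     (gauss_noise c \<bind> (\<lambda>z. loop D k (w, \<rho> - c, \<rho>ng, hist, Some (f (grad_center D w + z)))))
     (gauss_noise c \<bind> (\<lambda>z. loop D' k (w, \<rho> - c, \<rho>ng, hist, Some (f (grad_center D' w + z)))))"
proof (cases "\<rho> \<le> c")
  case True
  then have "\<rho> - c \<le> 0" by simp
  then show ?thesis
    using renyi_bounded_return_budget[OF \<alpha>]
    by (simp add: dpagd_loop_exhausted bind_return_const prob_space_gauss_vec[OF noise_pos[OF c]])
next
  case False
  have "renyi_bounded \<alpha> (exp ((\<alpha> - 1) * (c + (\<rho> - c))))
     (gauss_noise c \<bind> (\<lambda>z. loop D k (w, \<rho> - c, \<rho>ng, hist, Some (f (grad_center D w + z)))))
     (gauss_noise c \<bind> (\<lambda>z. loop D' k (w, \<rho> - c, \<rho>ng, hist, Some (f (grad_center D' w + z)))))"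
  proof (rule gauss_step_renyi_bounded[OF \<alpha> c Cgrad _ loop_Some_kernel[OF \<rho>ng f] loop_Some_kernel[OF \<rho>ng f]])
    show "norm (grad_center D w - grad_center D' w) \<le> Cgrad"
      using clipped_grad_sensitivity[OF Cgrad n] by (simp add: grad_center_def)
    have "max 0 (\<rho> - c) = \<rho> - c" using False by simp
    with IH show "renyi_bounded \<alpha> (exp ((\<alpha> - 1) * (\<rho> - c)))
       (loop D k (w, \<rho> - c, \<rho>ng, hist, Some (f y))) (loop D' k (w, \<rho> - c, \<rho>ng, hist, Some (f y)))" for y
      by metis
  qed
  then show ?thesis using \<rho> by simp
qed

lemma average_dir_measurable: "average_dir c g \<in> borel \<rightarrow>\<^sub>M borel"
  unfolding average_dir_def[abs_def] by measurable

text \<open>A positive index is stopped by the explicit guard. Index 0 still draws Gaussian noise,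
  but with even less budget left, so the loop ignores it.\<close>

lemma select_step_exhausted:
  assumes "\<rho> \<le> 0" "0 < \<rho>ng"
  shows "select_step D k w \<rho> \<rho>ng hist g i = return borel w"
proof -
  have c: "0 < \<gamma> * \<rho>ng" using \<gamma> assms by simp
  then have "\<rho> - \<gamma> * \<rho>ng \<le> 0" using assms by simp
  then show ?thesis using assms
    by (simp add: select_step_def refine_step_def dpagd_loop_exhausted bind_return_const
        prob_space_gauss_vec[OF noise_pos[OF c]])
qed

text \<open>A step that overdraws the budget leaks nothing, since from then on the loop returns the current
  iterate whatever the noise; hence the bound by the remaining budget rather than by the amount spent.\<close>
lemma loop_renyi_bounded:
  assumes \<alpha>: "1 < \<alpha>" and n: "neighbors D D'" and "0 < \<rho>ng"
  shows "renyi_bounded \<alpha> (exp ((\<alpha> - 1) * max 0 \<rho>)) (loop D k (w, \<rho>, \<rho>ng, hist, ph)) (loop D' k (w, \<rho>, \<rho>ng, hist, ph))"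
  using \<open>0 < \<rho>ng\<close>
proof (induction k arbitrary: w \<rho> \<rho>ng hist ph)
  case 0
  then show ?case using renyi_bounded_return_budget[OF \<alpha>] by simp
next
  case (Suc k)
  note \<rho>ng = \<open>0 < \<rho>ng\<close>
  show ?case
  proof (cases "0 < \<rho>")
    case False
    then have "\<rho> \<le> 0" by simp
    then show ?thesis
      unfolding dpagd_loop_exhausted[OF \<open>\<rho> \<le> 0\<close>] by (intro renyi_bounded_return_budget[OF \<alpha>])
  next
    case \<rho>: True
    show ?thesis
    proof (cases ph)
      case None
      have "(\<lambda>y. y /\<^sub>R norm y) \<in> borel \<rightarrow>\<^sub>M (borel :: 'a measure)" by measurable
      from gauss_step_budget[OF \<alpha> n \<rho>ng \<rho>ng this \<rho> Suc.IH[OF \<rho>ng]]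
      show ?thesis unfolding None loop_None[OF \<rho>] .
    next
      case (Some g)
      show ?thesis
      proof (cases "\<rho> \<le> \<rho>nmax")
        case True
        then have "select_step E k w (\<rho> - \<rho>nmax) \<rho>ng hist g = (\<lambda>_. return borel w)" for E
          by (intro ext select_step_exhausted) (use \<rho>ng in simp_all)
        then show ?thesis
          using renyi_bounded_return_budget[OF \<alpha>]
          unfolding Some loop_Some[OF \<rho>]
          by (simp add: bind_return_const prob_space_noisy_max[OF nmax_pos(2)])
      next
        case False
        then have \<rho>': "0 < \<rho> - \<rho>nmax" by simp
        have c: "0 < \<gamma> * \<rho>ng" "0 < (1 + \<gamma>) * \<rho>ng" using \<gamma> \<rho>ng by simp_all
        have sel: "renyi_bounded \<alpha> (exp ((\<alpha> - 1) * (\<rho> - \<rho>nmax)))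
           (select_step D k w (\<rho> - \<rho>nmax) \<rho>ng hist g i) (select_step D' k w (\<rho> - \<rho>nmax) \<rho>ng hist g i)" for i
        proof -
          have m: "max 0 (\<rho> - \<rho>nmax) = \<rho> - \<rho>nmax" using \<rho>' by simp
          show ?thesis
            using Suc.IH[OF \<rho>ng, of "\<rho> - \<rho>nmax" "w - (\<Phi> hist ! i) *\<^sub>R g" "hist @ [\<Phi> hist ! i]" None] \<rho>'
              gauss_step_budget[OF \<alpha> n c average_dir_measurable \<rho>' Suc.IH[OF c(2)], of w hist \<rho>ng g]
            unfolding m select_step_def refine_step_def by simp
        qed
        have meas: "select_step E k w (\<rho> - \<rho>nmax) \<rho>ng hist g \<in> count_space UNIV \<rightarrow>\<^sub>M prob_algebra borel" for E
        proof -
          have "prob_space (loop E k (w', \<rho>', \<rho>ng', hist', None))" "sets (loop E k (w', \<rho>', \<rho>ng', hist', None)) = sets borel"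
            if "0 < \<rho>ng'" for w' \<rho>' \<rho>ng' hist'
            using measurable_space[OF loop_kernel(1)[OF that, of E k \<rho>' hist'], of w'] by (auto simp: space_prob_algebra)
          moreover have "refine_step E k w (\<rho> - \<rho>nmax) \<rho>ng hist g \<in> space (prob_algebra borel)"
            using measurable_space[OF refine_step_kernel[OF \<rho>ng loop_kernel(2)[OF c(2)]], of "(w, g)" E k "\<rho> - \<rho>nmax" hist]
            by (simp add: space_pair_measure)
          ultimately show ?thesis using \<rho>ng
            by (auto simp: select_step_def space_prob_algebra prob_space_return)
        qed
        \<comment> \<open>Selection runs at pure privacy level sqrt (2 * \<rho>nmax), and half the
          square of this level is \<rho>nmax.\<close>
        have nm: "renyi_bounded \<alpha> (exp ((\<alpha> - 1) * ((sqrt (2 * \<rho>nmax))\<^sup>2 / 2)))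
            (noisy_max (scores D hist w g) Cobj (sqrt (2 * \<rho>nmax)))
            (noisy_max (scores D' hist w g) Cobj (sqrt (2 * \<rho>nmax)))"
        proof (rule noisy_max_renyi_bounded[OF \<alpha> nmax_pos(1) Cobj])
          \<comment> \<open>The regularizer is the same for both databases and cancels from each
            score change.\<close>
          fix i j assume ij: "i < length (scores D hist w g)" "j < length (scores D hist w g)"
          then show "\<bar>scores D' hist w g ! j - scores D hist w g ! j - (scores D' hist w g ! i - scores D hist w g ! i)\<bar> \<le> Cobj"
            using clipped_obj_sensitivity[where loss=loss, OF Cobj loss_nonneg n, of "w - (\<Phi> hist ! j) *\<^sub>R g" "w - (\<Phi> hist ! i) *\<^sub>R g"]
            by (simp add: length_scores scores_nth abs_le_iff algebra_simps)
        qed (simp_all only: length_scores \<Phi>)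
        have sp: "noisy_max v Cobj (sqrt (2 * \<rho>nmax)) \<in> space (prob_algebra (count_space UNIV))" for v
          by (simp add: space_prob_algebra prob_space_noisy_max[OF nmax_pos(2)])
        have "renyi_bounded \<alpha> (exp ((\<alpha> - 1) * \<rho>nmax) * exp ((\<alpha> - 1) * (\<rho> - \<rho>nmax)))
           (noisy_max (scores D hist w g) Cobj (sqrt (2 * \<rho>nmax)) \<bind> select_step D k w (\<rho> - \<rho>nmax) \<rho>ng hist g)
           (noisy_max (scores D' hist w g) Cobj (sqrt (2 * \<rho>nmax)) \<bind> select_step D' k w (\<rho> - \<rho>nmax) \<rho>ng hist g)"
        proof (rule renyi_bounded_bind[OF \<alpha> sp sp meas meas])
          show "renyi_bounded \<alpha> (exp ((\<alpha> - 1) * \<rho>nmax))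
            (noisy_max (scores D hist w g) Cobj (sqrt (2 * \<rho>nmax)))
            (noisy_max (scores D' hist w g) Cobj (sqrt (2 * \<rho>nmax)))"
            using nm \<rho>nmax by simp
        qed (simp_all add: sel)
        moreover have "exp ((\<alpha> - 1) * \<rho>nmax) * exp ((\<alpha> - 1) * (\<rho> - \<rho>nmax)) = exp ((\<alpha> - 1) * max 0 \<rho>)"
          using \<rho> by (simp add: max_def algebra_simps flip: exp_add)
        ultimately show ?thesis unfolding Some loop_Some[OF \<rho>] by simp
      qed
    qed
  qed
qed

end

section \<open>The mechanism: initial budget and conversion to the two privacy guarantees\<close>

lemma zCDP_budget_unique:
  assumes "0 < \<delta>" "\<delta> < 1" "0 < \<rho>" "\<epsilon> = \<rho> + 2 * sqrt (\<rho> * ln (1 / \<delta>))"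
  shows "(THE \<rho>. 0 < \<rho> \<and> \<epsilon> = \<rho> + 2 * sqrt (\<rho> * ln (1 / \<delta>))) = \<rho>"
proof (rule the_equality)
  have l: "0 < ln (1 / \<delta>)" using assms by simp
  \<comment> \<open>Strict monotonicity in the budget gives uniqueness, which the \<open>THE\<close>
    in \<open>dpagd\<close> requires.\<close>
  have mono: "x + 2 * sqrt (x * ln (1 / \<delta>)) < y + 2 * sqrt (y * ln (1 / \<delta>))" if "x < y" for x y
  proof -
    have "x * ln (1 / \<delta>) < y * ln (1 / \<delta>)" using that l by (rule mult_strict_right_mono)
    then have "sqrt (x * ln (1 / \<delta>)) < sqrt (y * ln (1 / \<delta>))" by (rule real_sqrt_less_mono)
    then show ?thesis using that by linarith
  qed
  show "0 < \<rho> \<and> \<epsilon> = \<rho> + 2 * sqrt (\<rho> * ln (1 / \<delta>))" using assms by simp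
  fix x assume "0 < x \<and> \<epsilon> = x + 2 * sqrt (x * ln (1 / \<delta>))"
  then have "x + 2 * sqrt (x * ln (1 / \<delta>)) = \<rho> + 2 * sqrt (\<rho> * ln (1 / \<delta>))" using assms by metis
  then show "x = \<rho>" using mono[of x \<rho>] mono[of \<rho> x] by (metis less_irrefl linorder_less_linear)
qed

theorem theorem5p1:
  fixes loss :: "'a::euclidean_space \<Rightarrow> 'a \<times> real \<Rightarrow> real"
    and r :: "'a \<Rightarrow> real"
    and w0 :: 'a
    and \<Phi> :: "real list \<Rightarrow> real list"
    and \<epsilon> \<delta> \<rho> Cobj Cgrad \<rho>nmax \<rho>ng \<gamma> :: real
  assumes "0 < \<epsilon>" and "0 < \<delta>" and "\<delta> < 1"
    and "0 < \<rho>" and "\<epsilon> = \<rho> + 2 * sqrt (\<rho> * ln (1 / \<delta>))"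
    and "0 < Cobj" and "0 < Cgrad" and "0 < \<rho>nmax" and "0 < \<rho>ng" and "0 < \<gamma>"
    and "\<forall>w d. 0 \<le> loss w d"
    and "\<forall>d w. (\<lambda>v. loss v d) differentiable (at w)"
    and "\<forall>w. r differentiable (at w)"
    and "\<forall>hist. 2 \<le> length (\<Phi> hist) \<and> \<Phi> hist ! 0 = 0 \<and> distinct (\<Phi> hist)"
  shows "zCDP \<rho> (dpagd loss r Cobj Cgrad \<rho>nmax \<rho>ng \<gamma> w0 \<Phi> \<epsilon> \<delta>)
       \<and> DP \<epsilon> \<delta> (dpagd loss r Cobj Cgrad \<rho>nmax \<rho>ng \<gamma> w0 \<Phi> \<epsilon> \<delta>)"
proof -
  have "0 < length (\<Phi> hist)" for hist
    using assms(14) by (metis less_le_trans zero_less_numeral)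
  then interpret dpagd_setting loss r \<Phi> Cobj Cgrad \<rho>nmax \<gamma>
    by unfold_locales (use assms in auto)
  define M where "M = dpagd loss r Cobj Cgrad \<rho>nmax \<rho>ng \<gamma> w0 \<Phi> \<epsilon> \<delta>"
  have M: "M D = loop D (2 * nat \<lceil>\<rho> / \<rho>nmax\<rceil> + 4) (w0, \<rho>, \<rho>ng, [], None)" for D
    unfolding M_def dpagd_def Let_def zCDP_budget_unique[OF assms(2-5)] ..
  have prob: "prob_space (M D)" for D
    using measurable_space[OF loop_kernel(1)[OF \<open>0 < \<rho>ng\<close>], of w0 D _ \<rho> "[]"]
    unfolding M by (simp add: space_prob_algebra)
  have bounded: "renyi_bounded \<alpha> (exp ((\<alpha> - 1) * \<rho>)) (M D) (M D')" if "1 < \<alpha>" "neighbors D D'" for \<alpha> D D'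
    using loop_renyi_bounded[OF that \<open>0 < \<rho>ng\<close>, of \<rho>] \<open>0 < \<rho>\<close> unfolding M by simp
  have "zCDP \<rho> M"
    unfolding zCDP_def
    using renyi_bounded_imp_renyi_divergence[OF bounded _ prob prob] \<open>0 < \<rho>\<close> by auto
  moreover have "DP \<epsilon> \<delta> M"
    unfolding DP_def
  proof (intro allI impI ballI)
    fix D D' :: "('a \<times> real) multiset" and S
    assume n: "neighbors D D'" and S: "S \<in> sets (M D)"
    \<comment> \<open>minimises (\<alpha> - 1) * (\<alpha> * \<rho> - \<epsilon>)\<close>
    define \<alpha> where "\<alpha> = (\<epsilon> + \<rho>) / (2 * \<rho>)"
    have l: "0 < ln (1 / \<delta>)" using assms by simp
    have sq: "0 < sqrt (\<rho> * ln (1 / \<delta>))" using l assms(4) by simp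
    have e: "\<epsilon> - \<rho> = 2 * sqrt (\<rho> * ln (1 / \<delta>))" using assms(5) by simp
    then have \<alpha>: "1 < \<alpha>" using sq assms(4) by (simp add: \<alpha>_def field_simps)
    \<comment> \<open>The minimal exponent is -(\<epsilon> - \<rho>)^2 / (4 * \<rho>); the equation
      defining \<rho> says precisely that this equals ln \<delta>, so the additive term becomes
      \<delta>.\<close>
    have "(\<epsilon> - \<rho>)\<^sup>2 = 4 * (\<rho> * ln (1 / \<delta>))" unfolding e using l assms(4) by (simp add: power_mult_distrib)
    moreover have "(\<alpha> - 1) * (\<alpha> * \<rho> - \<epsilon>) = - ((\<epsilon> - \<rho>)\<^sup>2 / (4 * \<rho>))"
      using assms(4) by (simp add: \<alpha>_def field_simps power2_eq_square)
    ultimately have "(\<alpha> - 1) * (\<alpha> * \<rho> - \<epsilon>) = ln \<delta>" using assms by (simp add: ln_div)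
    then show "measure (M D) S \<le> exp \<epsilon> * measure (M D') S + \<delta>"
      using renyi_bounded_imp_DP_ineq[OF bounded[OF \<alpha> n] \<alpha> prob prob S, of \<epsilon>] assms(2) by simp
  qed
  ultimately show ?thesis by (simp add: M_def)
qed

end
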